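(* Let $\mathbf{x}^{(1)},\ldots,\mathbf{x}^{(n)}$ be a set of $n$ i.i.d. samples from the uniform distribution on the $d$-dimensional unit sphere $\mathbb{S}_d$, with ground-truth labels given by some halfspace with normal vector $\mathbf{w}^\ast$, i.e., the label of $\mathbf{x}^{(i)}$ is $\mathrm{sign}(\mathbf{w}^\ast\cdot\mathbf{x}^{(i)})$. Then any algorithm that predicts the labels of $\mathbf{x}^{(1)},\ldots,\mathbf{x}^{(n)}$ in random order makes at least $\Omega(d\log n)$ mistakes in expectation. Moreover, this is true even if the labeling algorithm predicts labels for only $1\%$ of the samples $\mathbf{x}^{(1)},\ldots,\mathbf{x}^{(n)}$.
   Context: $\mathbb{S}_d$ denotes the unit sphere in $\mathbb{R}^d$. Random-order online learning: the target halfspace is unknown to the learner, and the learner has access to the full set of unlabeled points. In each round a point $\mathbf{x}$ is picked uniformly at random (without replacement) from the unlabeled data, the learner makes a prediction $z\in\{\pm1\}$ about its label, and then the true label $\mathrm{sign}(\mathbf{w}^\ast\cdot\mathbf{x})$ is revealed to the learner. A mistake is a round in which the prediction differs from the true label. $\Omega(\cdot)$ is standard asymptotic notation.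
   Formalization: Proved for d ≥ 2 and n ≥ d^(1+ε), any ε > 0, with the Ω constant depending only on ε: a uniform bound fails for n near d (at most n mistakes) and for d = 1. The halfspace is worst-case for the algorithm; the 1% are the first rounds of the random order. *)

theory Defs
  imports "HOL-Probability.Probability" "HOL-Combinatorics.Combinatorics"
begin

(* The dimension d and the sample size n must be quantified inside the statement, below the
   constant hidden in the asymptotic notation, so they cannot be type indices.  A vector of R^d
   is a function on {..<d}, its Euclidean norm is L2_set x {..<d}, and the unit sphere is
   {x. L2_set x {..<d} = 1}. *)

abbreviation euclidean_borel :: "nat \<Rightarrow> (nat \<Rightarrow> real) measure" where
  "euclidean_borel d \<equiv> Pi\<^sub>M {..<d} (\<lambda>_. borel)"

definition unit_ball :: "nat \<Rightarrow> (nat \<Rightarrow> real) set" where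
  "unit_ball d = {x \<in> space (Pi\<^sub>M {..<d} (\<lambda>_. lborel)). L2_set x {..<d} \<le> 1}"

definition normalize_vec :: "nat \<Rightarrow> (nat \<Rightarrow> real) \<Rightarrow> nat \<Rightarrow> real" where
  "normalize_vec d x = (\<lambda>i\<in>{..<d}. x i / L2_set x {..<d})"

(* The normalised surface measure, given as the cone measure: the measure of a set A of unit
   vectors is vol {t x | x in A, 0 < t <= 1} / vol (unit ball).  It is a measure on R^d that is
   concentrated on the sphere (AE_uniform_sphere below). *)
definition uniform_sphere :: "nat \<Rightarrow> (nat \<Rightarrow> real) measure" where
  "uniform_sphere d =
     distr (uniform_measure (Pi\<^sub>M {..<d} (\<lambda>_. lborel)) (unit_ball d))
       (euclidean_borel d) (normalize_vec d)"

definition iid_sphere_samples :: "nat \<Rightarrow> nat \<Rightarrow> (nat \<Rightarrow> nat \<Rightarrow> real) measure" where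
  "iid_sphere_samples d n = Pi\<^sub>M {..<n} (\<lambda>_. uniform_sphere d)"

(* The value at 0 is a convention; for w \<noteq> 0 it concerns a null set of samples only. *)
definition halfspace_label :: "nat \<Rightarrow> (nat \<Rightarrow> real) \<Rightarrow> (nat \<Rightarrow> real) \<Rightarrow> int" where
  "halfspace_label d w x = (if (\<Sum>i<d. w i * x i) \<ge> 0 then 1 else - 1)"

(* A s X h i is the predicted label of the point X i, where s is the learner's internal random
   seed, X the whole unlabeled data set, and h the list of the indices seen in the earlier rounds
   (oldest first) together with their revealed labels.  The learner's own earlier predictions are
   functions of these arguments. *)
type_synonym learner =
  "real \<Rightarrow> (nat \<Rightarrow> nat \<Rightarrow> real) \<Rightarrow> (nat \<times> int) list \<Rightarrow> nat \<Rightarrow> int"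

(* R is the distribution of the seed. *)
definition online_learner :: "nat \<Rightarrow> nat \<Rightarrow> real measure \<Rightarrow> learner \<Rightarrow> bool" where
  "online_learner d n R A \<longleftrightarrow> prob_space R \<and>
     (\<forall>h i. (\<lambda>(s, X). A s X h i)
        \<in> R \<Otimes>\<^sub>M iid_sphere_samples d n \<rightarrow>\<^sub>M count_space {- 1, 1})"

(* Mistakes in the first m rounds, when round t (counted from 0) presents the point X (p ! t). *)
definition mistakes ::
  "nat \<Rightarrow> nat \<Rightarrow> learner \<Rightarrow> (nat \<Rightarrow> real) \<Rightarrow> real \<Rightarrow> (nat \<Rightarrow> nat \<Rightarrow> real) \<Rightarrow> nat list \<Rightarrow> nat" where
  "mistakes d m A w s X p =
     card {t. t < m \<and>
       A s X (map (\<lambda>i. (i, halfspace_label d w (X i))) (take t p)) (p ! t)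
         \<noteq> halfspace_label d w (X (p ! t))}"

(* Drawing the points one by one, uniformly and without replacement, makes the order p a
   uniformly random permutation of the indices; it is independent of the seed and the samples. *)
definition expected_mistakes ::
  "nat \<Rightarrow> nat \<Rightarrow> nat \<Rightarrow> real measure \<Rightarrow> learner \<Rightarrow> (nat \<Rightarrow> real) \<Rightarrow> real" where
  "expected_mistakes d n m R A w =
     (\<integral>(s, X, p). real (mistakes d m A w s X p)
        \<partial>(R \<Otimes>\<^sub>M (iid_sphere_samples d n
             \<Otimes>\<^sub>M measure_pmf (pmf_of_set (permutations_of_set {..<n})))))"

lemma unit_ball_sets [measurable]: "unit_ball d \<in> sets (Pi\<^sub>M {..<d} (\<lambda>_. lborel))"
  unfolding unit_ball_def L2_set_def by measurable

lemma emeasure_unit_ball: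
  "emeasure (Pi\<^sub>M {..<d} (\<lambda>_. lborel)) (unit_ball d) = ennreal (unit_ball_vol (real d))"
  using emeasure_cball_aux[of "{..<d}" 1]
  by (simp add: unit_ball_def L2_set_def Int_def conj_commute)

lemma measurable_normalize_vec [measurable]:
  "normalize_vec d \<in> Pi\<^sub>M {..<d} (\<lambda>_. lborel) \<rightarrow>\<^sub>M euclidean_borel d"
  unfolding normalize_vec_def L2_set_def by measurable

lemma prob_space_uniform_sphere: "prob_space (uniform_sphere d)"
proof -
  have "prob_space (uniform_measure (Pi\<^sub>M {..<d} (\<lambda>_. lborel)) (unit_ball d))"
    using unit_ball_vol_pos[of "real d", OF of_nat_0_le_iff]
    by (intro prob_space_uniform_measure) (simp_all add: emeasure_unit_ball ennreal_eq_0_iff not_le)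
  then show ?thesis
    unfolding uniform_sphere_def by (rule prob_space.prob_space_distr) simp
qed

lemma sets_uniform_sphere [measurable_cong, simp]:
  "sets (uniform_sphere d) = sets (euclidean_borel d)"
  by (simp add: uniform_sphere_def)

lemma AE_uniform_sphere:
  assumes "d \<ge> 1"
  shows "AE x in uniform_sphere d. L2_set x {..<d} = 1"
proof -
  let ?L = "Pi\<^sub>M {..<d} (\<lambda>_. lborel :: real measure)"
  interpret product_sigma_finite "\<lambda>_ :: nat. lborel :: real measure" ..
  let ?Z = "Pi\<^sub>E {..<d} (\<lambda>_. {0 :: real})"
  have "emeasure ?L ?Z = (\<Prod>i<d. emeasure lborel {0 :: real})"
    by (rule emeasure_PiM) auto
  also have "\<dots> = 0" using assms by (auto simp: prod_zero_iff)
  finally have "AE x in ?L. x \<notin> ?Z"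
    by (intro AE_not_in null_setsI sets_PiM_I_finite) auto
  moreover have "x \<in> ?Z" if "x \<in> space ?L" "L2_set x {..<d} = 0" for x
    using that by (auto simp: L2_set_eq_0_iff space_PiM PiE_iff extensional_def)
  ultimately have *: "AE x in ?L. L2_set x {..<d} \<noteq> 0" by auto
  have "AE x in ?L. x \<in> unit_ball d \<longrightarrow> L2_set (normalize_vec d x) {..<d} = 1"
    using *
  proof eventually_elim
    case (elim x)
    let ?r = "L2_set x {..<d}"
    have "L2_set (normalize_vec d x) {..<d} = L2_set (\<lambda>i. (1 / ?r) * x i) {..<d}"
      by (rule L2_set_cong) (auto simp: normalize_vec_def)
    also have "\<dots> = (1 / ?r) * ?r"
      by (rule L2_set_right_distrib[symmetric]) (simp add: L2_set_nonneg)
    finally show ?case using elim by simp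
  qed
  then have "AE x in uniform_measure ?L (unit_ball d). L2_set (normalize_vec d x) {..<d} = 1"
    by (intro AE_uniform_measureI) auto
  moreover have "{x \<in> space (euclidean_borel d). L2_set x {..<d} = 1} \<in> sets (euclidean_borel d)"
    unfolding L2_set_def by measurable
  ultimately show ?thesis
    unfolding uniform_sphere_def by (subst AE_distr_iff) auto
qed

lemma measurable_halfspace_label:
  "(\<lambda>X. halfspace_label d w (X i)) \<in> iid_sphere_samples d n \<rightarrow>\<^sub>M count_space UNIV"
proof (cases "i < n")
  case True
  have "halfspace_label d w \<in> euclidean_borel d \<rightarrow>\<^sub>M count_space UNIV"
    unfolding halfspace_label_def by measurable
  then have "halfspace_label d w \<in> uniform_sphere d \<rightarrow>\<^sub>M count_space UNIV"
    by (simp cong: measurable_cong_sets)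
  with True show ?thesis
    unfolding iid_sphere_samples_def
    by (intro measurable_compose[OF measurable_component_singleton]) auto
next
  case False
  have "(\<lambda>X. halfspace_label d w (X i)) \<in> iid_sphere_samples d n \<rightarrow>\<^sub>M count_space UNIV
      \<longleftrightarrow> (\<lambda>_. halfspace_label d w undefined) \<in> iid_sphere_samples d n \<rightarrow>\<^sub>M count_space UNIV"
    using False by (intro measurable_cong) (auto simp: iid_sphere_samples_def space_PiM PiE_iff extensional_def)
  then show ?thesis by simp
qed

lemma measurable_labelled_list:
  "(\<lambda>X. map (\<lambda>i. (i, halfspace_label d w (X i))) is)
     \<in> iid_sphere_samples d n \<rightarrow>\<^sub>M count_space UNIV"
proof (induction "is")
  case (Cons j js)
  note [measurable] = Cons.IH measurable_halfspace_label
  have "(\<lambda>X. (j, halfspace_label d w (X j)) # map (\<lambda>i. (i, halfspace_label d w (X i))) js)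
     \<in> iid_sphere_samples d n \<rightarrow>\<^sub>M count_space UNIV"
    by (rule measurable_compose_countable[OF _ Cons.IH]) measurable
  then show ?case by simp
qed simp

lemma measurable_mistakes:
  assumes "online_learner d n R A"
  shows "(\<lambda>(s, X, p). real (mistakes d m A w s X p)) \<in> borel_measurable
    (R \<Otimes>\<^sub>M (iid_sphere_samples d n \<Otimes>\<^sub>M measure_pmf (pmf_of_set (permutations_of_set {..<n}))))"
    (is "_ \<in> borel_measurable (R \<Otimes>\<^sub>M (?S \<Otimes>\<^sub>M ?P))")
proof -
  note [measurable] = measurable_labelled_list measurable_halfspace_label
  have A: "(\<lambda>(s, X). A s X h i) \<in> R \<Otimes>\<^sub>M ?S \<rightarrow>\<^sub>M count_space UNIV" for h i
    using assms unfolding online_learner_def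
    by (auto intro: measurable_compose[where N = "count_space {- 1, 1}"])
  have [measurable]: "(\<lambda>z. A (fst z) (fst (snd z)) h i) \<in> R \<Otimes>\<^sub>M (?S \<Otimes>\<^sub>M ?P) \<rightarrow>\<^sub>M count_space UNIV" for h i
    using measurable_compose[OF _ A, of "\<lambda>z. (fst z, fst (snd z))" "R \<Otimes>\<^sub>M (?S \<Otimes>\<^sub>M ?P)" h i] by simp
  have [measurable]: "(\<lambda>z. A (fst z) (fst (snd z))
      (map (\<lambda>i. (i, halfspace_label d w (fst (snd z) i))) is) i) \<in> R \<Otimes>\<^sub>M (?S \<Otimes>\<^sub>M ?P) \<rightarrow>\<^sub>M count_space UNIV"
    for i "is"
    by (rule measurable_compose_countable[where g = "\<lambda>z. map (\<lambda>i. (i, halfspace_label d w (fst (snd z) i))) is"])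
      measurable
  have *: "(\<lambda>z. \<Sum>t<m. of_bool (A (fst z) (fst (snd z))
       (map (\<lambda>i. (i, halfspace_label d w (fst (snd z) i))) (take t p)) (p ! t)
         \<noteq> halfspace_label d w (fst (snd z) (p ! t))) :: real)
     \<in> borel_measurable (R \<Otimes>\<^sub>M (?S \<Otimes>\<^sub>M ?P))" for p
    unfolding of_bool_def by measurable
  have "real (mistakes d m A w s X p) = (\<Sum>t<m. of_bool (A s X
       (map (\<lambda>i. (i, halfspace_label d w (X i))) (take t p)) (p ! t)
         \<noteq> halfspace_label d w (X (p ! t))))" for s X p
    by (simp add: mistakes_def of_bool_def sum.If_cases Int_def)
  then have "(\<lambda>z. real (mistakes d m A w (fst z) (fst (snd z)) p))
     \<in> borel_measurable (R \<Otimes>\<^sub>M (?S \<Otimes>\<^sub>M ?P))" for p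
    using * by simp
  then have "(\<lambda>z. real (mistakes d m A w (fst z) (fst (snd z)) (snd (snd z))))
     \<in> borel_measurable (R \<Otimes>\<^sub>M (?S \<Otimes>\<^sub>M ?P))"
    by (rule measurable_compose_countable[where g = "\<lambda>z. snd (snd z)"]) measurable
  then show ?thesis by (simp add: case_prod_beta)
qed

end

theory Submission
  imports Defs
begin

text \<open>The normal vector is drawn as \<open>w = (u, 1)\<close> with \<open>u\<close> uniform in the unit ball of dimension
  \<open>k = d - 1\<close>.  In round \<open>t\<close> the learner knows only the cell of the earlier labels that contains
  \<open>u\<close>, so it errs on the next point \<open>x\<close> with probability at least the sum over the cells \<open>C\<close> of
  \<open>min (P (C \<inter> H)) (P (C - H)) \<ge> P (C \<inter> H) * P (C - H) / P C\<close>, where \<open>H\<close> is the half-space of the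
  normals that label \<open>x\<close> positively.  Averaged over \<open>x\<close>, the product is the integral over
  \<open>u, v \<in> C\<close> of the probability that \<open>x\<close> separates \<open>u\<close> from \<open>v\<close>, which is at least a constant times
  the distance of \<open>u\<close> and \<open>v\<close>.  A ball of radius \<open>\<rho>\<close> has prior probability at most \<open>\<rho> ^ k\<close>, so
  most of a cell of larger probability is \<open>\<rho>\<close>-far from each of its points.  Since affine sign
  patterns have VC dimension \<open>k\<close>, there are at most \<open>(e (t + k) / k) ^ k\<close> cells, and
  \<open>\<rho> = k / (2 e (t + k))\<close> gives an error of order \<open>k / (t + k)\<close> in round \<open>t\<close>.  Knowing the
  unlabelled points does not help, as they are independent of \<open>u\<close>.\<close>

section \<open>Sign patterns of affine functions\<close>

text \<open>Gaussian elimination on the last coordinate: more vectors than coordinates are linearly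
  dependent. Indexing the vectors by \<open>S\<close> admits repetitions.\<close>

lemma nontrivial_relation:
  fixes y :: "'a \<Rightarrow> nat \<Rightarrow> real"
  assumes "finite S" "k < card S"
  shows "\<exists>a. (\<exists>s\<in>S. a s \<noteq> 0) \<and> (\<forall>j<k. (\<Sum>s\<in>S. a s * y s j) = 0)"
  using assms
proof (induction k arbitrary: S y)
  case 0
  then have "S \<noteq> {}" by auto
  then show ?case by (intro exI[of _ "\<lambda>_. 1"]) auto
next
  case (Suc k)
  show ?case
  proof (cases "\<forall>s\<in>S. y s k = 0")
    case True
    have "\<exists>a. (\<exists>s\<in>S. a s \<noteq> 0) \<and> (\<forall>j<k. (\<Sum>s\<in>S. a s * y s j) = 0)"
      using Suc by auto
    then show ?thesis using True by (auto simp: less_Suc_eq)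
  next
    case False
    then obtain r where r: "r \<in> S" "y r k \<noteq> 0" by auto
    \<comment> \<open>Row reduction with pivot \<open>r\<close>: coordinate \<open>k\<close> of
      every \<open>?z s\<close> is 0.\<close>
    let ?z = "\<lambda>s j. y s j - y s k / y r k * y r j"
    have "k < card (S - {r})" using Suc.prems r by simp
    with Suc.IH[of "S - {r}" ?z] Suc.prems(1) obtain a where a:
      "\<exists>s\<in>S - {r}. a s \<noteq> 0" "\<And>j. j < k \<Longrightarrow> (\<Sum>s\<in>S - {r}. a s * ?z s j) = 0" by auto
    \<comment> \<open>The pivot's coefficient is forced by coordinate \<open>k\<close>; in the other
      coordinates it contributes exactly the difference between \<open>?z\<close> and
      \<open>y\<close>.\<close>
    define q where "q = (\<Sum>s\<in>S - {r}. a s * y s k) / y r k"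
    let ?b = "a(r := - q)"
    have split: "(\<Sum>s\<in>S. ?b s * y s j) = (\<Sum>s\<in>S - {r}. a s * y s j) - q * y r j" for j
      using r Suc.prems(1) by (simp add: sum.remove[of S r])
    have "(\<Sum>s\<in>S. ?b s * y s j) = 0" if "j < Suc k" for j
    proof (cases "j = k")
      case True
      then show ?thesis using r by (simp only: split) (simp add: q_def)
    next
      case False
      have "(\<Sum>s\<in>S - {r}. a s * ?z s j) = (\<Sum>s\<in>S - {r}. a s * y s j) - q * y r j"
        by (simp add: q_def sum_subtractf right_diff_distrib sum_distrib_left divide_inverse mult_ac)
      with a(2)[of j] False that split show ?thesis by simp
    qed
    moreover have "\<exists>s\<in>S. ?b s \<noteq> 0" using a(1) by auto
    ultimately show ?thesis by blast
  qed
qed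

section \<open>Shattering and the Sauer-Shelah bound\<close>

definition shatters :: "'a set set \<Rightarrow> 'a set \<Rightarrow> bool" where
  "shatters F B \<longleftrightarrow> (\<forall>C\<subseteq>B. \<exists>A\<in>F. A \<inter> B = C)"

lemma shattersI: "(\<And>C. C \<subseteq> B \<Longrightarrow> \<exists>A\<in>F. A \<inter> B = C) \<Longrightarrow> shatters F B"
  by (simp add: shatters_def)

lemma shattersE:
  assumes "shatters F B" "C \<subseteq> B"
  obtains A where "A \<in> F" "A \<inter> B = C"
  using assms unfolding shatters_def by blast

text \<open>Pajor's form of the Sauer-Shelah lemma, by induction on the ground set.
  \<open>F0\<close> collects the traces on \<open>I\<close>, \<open>F1\<close> the traces that occur
  both with and without \<open>x\<close>, so that \<open>card F = card F0 + card F1\<close>. What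
  \<open>F0\<close> shatters is shattered by \<open>F\<close>, and what \<open>F1\<close> shatters
  remains shattered by \<open>F\<close> when \<open>x\<close> is added; the two kinds of sets differ
  in whether they contain \<open>x\<close>.\<close>

lemma card_le_card_shattered:
  assumes "finite I" "F \<subseteq> Pow I"
  shows "card F \<le> card {B \<in> Pow I. shatters F B}"
  using assms
proof (induction I arbitrary: F)
  case empty
  then have "F = {} \<or> F = {{}}" by auto
  then show ?case
  proof
    assume F: "F = {{}}"
    have "shatters {{}} {}" by (simp add: shatters_def)
    then have "{B \<in> Pow {}. shatters F B} = {{}}" unfolding F by blast
    with F show ?thesis by simp
  qed simp
next
  case (insert x I)
  define F0 F1 where "F0 = {A \<in> Pow I. A \<in> F \<or> insert x A \<in> F}"
    and "F1 = {A \<in> Pow I. A \<in> F \<and> insert x A \<in> F}"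
  define P Q where "P = {A \<in> Pow I. A \<in> F}" and "Q = {A \<in> Pow I. insert x A \<in> F}"
  have fin: "finite P" "finite Q" using insert.hyps insert.prems by (auto simp: P_def Q_def)
  have "F = P \<union> insert x ` Q"
  proof (intro set_eqI iffI)
    fix A assume A: "A \<in> F"
    show "A \<in> P \<union> insert x ` Q"
    proof (cases "x \<in> A")
      case True
      then have "A = insert x (A - {x})" "A - {x} \<in> Q"
        using A insert.prems by (auto simp: Q_def insert_absorb)
      then show ?thesis by blast
    qed (use A insert.prems in \<open>auto simp: P_def\<close>)
  qed (auto simp: P_def Q_def)
  moreover have "P \<inter> insert x ` Q = {}" using insert.hyps insert.prems by (auto simp: P_def)
  moreover have "inj_on (insert x) Q" using insert.hyps insert.prems by (auto simp: inj_on_def Q_def)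
  ultimately have "card F = card P + card Q"
    using fin by (simp add: card_Un_disjoint card_image)
  also have "\<dots> = card F0 + card F1"
  proof -
    have "F0 = P \<union> Q" "F1 = P \<inter> Q" by (auto simp: F0_def F1_def P_def Q_def)
    then show ?thesis using card_Un_Int[OF fin] by simp
  qed
  finally have card_F: "card F = card F0 + card F1" .
  let ?S = "\<lambda>G. {B \<in> Pow I. shatters G B}"
  have "card F0 \<le> card (?S F0)" "card F1 \<le> card (?S F1)"
    by (rule insert.IH, simp add: F0_def F1_def subset_eq)+
  moreover have "card (?S F0) + card (?S F1) = card (?S F0 \<union> insert x ` ?S F1)"
  proof -
    have "inj_on (insert x) (?S F1)" using insert.hyps insert.prems by (auto simp: inj_on_def)
    moreover have "?S F0 \<inter> insert x ` ?S F1 = {}" using insert.hyps insert.prems by auto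
    ultimately show ?thesis using insert.hyps insert.prems by (simp add: card_Un_disjoint card_image)
  qed
  moreover have "?S F0 \<union> insert x ` ?S F1 \<subseteq> {B \<in> Pow (insert x I). shatters F B}"
  proof -
    have "shatters F B" if "B \<subseteq> I" "shatters F0 B" for B
    proof -
      have "x \<notin> B" using that insert.hyps by auto
      show ?thesis
      proof (rule shattersI)
        fix C assume "C \<subseteq> B"
        with \<open>shatters F0 B\<close> obtain A where A: "A \<in> F0" "A \<inter> B = C" by (rule shattersE)
        moreover from this(2) have "insert x A \<inter> B = C" using \<open>x \<notin> B\<close> by blast
        ultimately show "\<exists>A\<in>F. A \<inter> B = C" unfolding F0_def by blast
      qed
    qed
    moreover have "shatters F (insert x B)" if "B \<subseteq> I" "shatters F1 B" for B
    proof -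
      have "x \<notin> B" using that insert.hyps by auto
      show ?thesis
      proof (rule shattersI)
        fix C assume C: "C \<subseteq> insert x B"
        then have "C - {x} \<subseteq> B" by auto
        with \<open>shatters F1 B\<close> obtain A where A: "A \<in> F1" "A \<inter> B = C - {x}" by (rule shattersE)
        from A(1) have xA: "x \<notin> A" "A \<in> F" "insert x A \<in> F"
          using insert.hyps(2) unfolding F1_def by blast+
        show "\<exists>A\<in>F. A \<inter> insert x B = C"
        proof (cases "x \<in> C")
          case True
          then have "insert x A \<inter> insert x B = C" using A xA by blast
          then show ?thesis using xA by blast
        next
          case False
          then have "A \<inter> insert x B = C" using A xA by blast
          then show ?thesis using xA by blast
        qed
      qed
    qed
    ultimately show ?thesis by auto
  qed
  then have "card (?S F0 \<union> insert x ` ?S F1) \<le> card {B \<in> Pow (insert x I). shatters F B}"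
    using insert.hyps insert.prems by (intro card_mono) auto
  ultimately show ?case using card_F by linarith
qed

lemma sauer_shelah:
  assumes "finite I" "F \<subseteq> Pow I" "\<And>B. B \<subseteq> I \<Longrightarrow> shatters F B \<Longrightarrow> card B \<le> k"
  shows "card F \<le> (\<Sum>i\<le>k. card I choose i)"
proof -
  have "card F \<le> card {B \<in> Pow I. shatters F B}" by (rule card_le_card_shattered) fact+
  also have "\<dots> \<le> card (\<Union>i\<le>k. {B. B \<subseteq> I \<and> card B = i})"
    using assms by (intro card_mono) auto
  also have "\<dots> = (\<Sum>i\<le>k. card {B. B \<subseteq> I \<and> card B = i})"
    using assms(1) by (intro card_UN_disjoint) auto
  also have "\<dots> = (\<Sum>i\<le>k. card I choose i)" by (simp add: n_subsets assms(1))
  finally show ?thesis .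
qed

text \<open>For \<open>z \<le> 1\<close> the weight \<open>z ^ i / z ^ k\<close> is at least 1
  whenever \<open>i \<le> k\<close>, so the sum is at most
  \<open>(1 + z) ^ T / z ^ k \<le> exp (z * T) / z ^ k\<close>. The choice \<open>z = k / T\<close>
  gives the claim; passing from \<open>t\<close> to \<open>T = t + k\<close> guarantees
  \<open>z \<le> 1\<close> also when \<open>t < k\<close>.\<close>

lemma sum_binomial_le:
  assumes "0 < k"
  shows "real (\<Sum>i\<le>k. t choose i) \<le> (exp 1 * real (t + k) / real k) ^ k"
proof -
  define T z where "T = t + k" and "z = real k / real T"
  have z: "0 < z" "z \<le> 1" using assms by (auto simp: T_def z_def)
  have "real (\<Sum>i\<le>k. t choose i) \<le> (\<Sum>i\<le>k. real (T choose i))"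
    by (auto intro!: sum_mono binomial_right_mono simp: T_def)
  also have "\<dots> \<le> (\<Sum>i\<le>k. real (T choose i) * (z ^ i * (1 / z) ^ k))"
  proof (intro sum_mono)
    fix i assume "i \<in> {..k}"
    then have "z ^ k \<le> z ^ i" using z by (intro power_decreasing) auto
    then have "1 \<le> z ^ i * (1 / z) ^ k" using z by (simp add: power_one_over)
    then show "real (T choose i) \<le> real (T choose i) * (z ^ i * (1 / z) ^ k)"
      by (metis mult.right_neutral mult_left_mono of_nat_0_le_iff)
  qed
  also have "\<dots> \<le> (\<Sum>i\<le>T. real (T choose i) * (z ^ i * (1 / z) ^ k))"
    using z by (intro sum_mono2) (auto simp: T_def)
  also have "\<dots> = (\<Sum>i\<le>T. real (T choose i) * z ^ i * 1 ^ (T - i)) * (1 / z) ^ k"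
    by (simp add: sum_distrib_right mult.assoc)
  also have "\<dots> = (z + 1) ^ T * (1 / z) ^ k" by (simp only: binomial_ring)
  also have "\<dots> \<le> exp z ^ T * (1 / z) ^ k"
    using z by (intro mult_right_mono power_mono) (auto simp: add.commute[of _ 1] exp_ge_add_one_self)
  also have "exp z ^ T = exp 1 ^ k"
    using assms by (simp add: z_def T_def flip: exp_of_nat_mult)
  also have "exp 1 ^ k * (1 / z) ^ k = (exp 1 * (1 / z)) ^ k" by (rule power_mult_distrib[symmetric])
  also have "exp 1 * (1 / z) = exp 1 * real (t + k) / real k" by (simp add: z_def T_def)
  finally show ?thesis .
qed

text \<open>The label of \<open>x\<close> under the normal vector with first coordinates
  \<open>u\<close> and last coordinate 1. As a function of \<open>u\<close> it is the sign of an
  affine form, with \<open>x k\<close> as constant term.\<close>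

definition pos_side :: "nat \<Rightarrow> (nat \<Rightarrow> real) \<Rightarrow> (nat \<Rightarrow> real) \<Rightarrow> bool" where
  "pos_side k u x \<longleftrightarrow> 0 \<le> x k + (\<Sum>i<k. u i * x i)"

text \<open>More than \<open>k\<close> points have a linear relation \<open>a\<close> among their
  first \<open>k\<close> coordinates, which makes \<open>\<Sum>s\<in>B. a s * f u s\<close>
  independent of \<open>u\<close>. Shattering would give a \<open>u\<close> that is positive exactly
  where \<open>a\<close> is and a \<open>v\<close> that is positive exactly where \<open>a\<close>
  is negative; the common value is then 0, every term vanishes, and \<open>a = 0\<close>.\<close>

lemma card_patterns:
  assumes "finite I"
  shows "card ((\<lambda>u. {i \<in> I. pos_side k u (X i)}) ` U) \<le> (\<Sum>i\<le>k. card I choose i)"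
proof (rule sauer_shelah[OF assms])
  fix B assume B: "B \<subseteq> I" and sh: "shatters ((\<lambda>u. {i \<in> I. pos_side k u (X i)}) ` U) B"
  show "card B \<le> k"
  proof (rule ccontr)
    assume "\<not> card B \<le> k"
    moreover have fin: "finite B" using B assms by (rule finite_subset)
    ultimately obtain a where a: "\<exists>s\<in>B. a s \<noteq> 0" "\<And>j. j < k \<Longrightarrow> (\<Sum>s\<in>B. a s * X s j) = 0"
      using nontrivial_relation[of B k X] by auto
    define f where "f u s = X s k + (\<Sum>i<k. u i * X s i)" for u s
    have const: "(\<Sum>s\<in>B. a s * f u s) = (\<Sum>s\<in>B. a s * X s k)" for u
    proof -
      have "(\<Sum>s\<in>B. a s * (\<Sum>i<k. u i * X s i)) = (\<Sum>i<k. u i * (\<Sum>s\<in>B. a s * X s i))"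
        unfolding sum_distrib_left by (subst sum.swap) (simp add: mult_ac)
      also have "\<dots> = 0" using a(2) by simp
      finally show ?thesis by (simp add: f_def distrib_left sum.distrib)
    qed
    have ex: "\<exists>u. \<forall>s\<in>B. 0 \<le> f u s \<longleftrightarrow> s \<in> C" if C: "C \<subseteq> B" for C
    proof -
      obtain u where "{i \<in> I. pos_side k u (X i)} \<inter> B = C"
        using sh C unfolding shatters_def by blast
      then show ?thesis using B by (intro exI[of _ u]) (auto simp: f_def pos_side_def)
    qed
    obtain u where u: "\<And>s. s \<in> B \<Longrightarrow> 0 \<le> f u s \<longleftrightarrow> 0 < a s"
      using ex[of "{s \<in> B. 0 < a s}"] by auto
    obtain v where v: "\<And>s. s \<in> B \<Longrightarrow> 0 \<le> f v s \<longleftrightarrow> a s < 0"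
      using ex[of "{s \<in> B. a s < 0}"] by auto
    \<comment> \<open>The value 0 counts as positive, so a vanishing product excludes only one sign
      of \<open>a s\<close>: at \<open>u\<close> it leaves \<open>a s \<ge> 0\<close>, at
      \<open>v\<close> it leaves \<open>a s \<le> 0\<close>.\<close>
    have u': "0 \<le> a s * f u s" "a s * f u s = 0 \<Longrightarrow> a s \<ge> 0" if "s \<in> B" for s
      using u[OF that] by (auto simp: zero_le_mult_iff not_le)
    have v': "a s * f v s \<le> 0" "a s * f v s = 0 \<Longrightarrow> a s \<le> 0" if "s \<in> B" for s
      using v[OF that] by (auto simp: mult_le_0_iff not_le)
    have "0 \<le> (\<Sum>s\<in>B. a s * f u s)" "(\<Sum>s\<in>B. a s * f v s) \<le> 0"
      using u' v' by (auto intro: sum_nonneg sum_nonpos)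
    then have "(\<Sum>s\<in>B. a s * f u s) = 0" "(\<Sum>s\<in>B. - (a s * f v s)) = 0"
      using const[of u] const[of v] by (simp_all add: sum_negf)
    then have "a s * f u s = 0" "a s * f v s = 0" if "s \<in> B" for s
      using that fin u'(1) v'(1) by (simp_all add: sum_nonneg_eq_0_iff)
    then have "a s = 0" if "s \<in> B" for s using u'(2) v'(2) that by (meson antisym)
    then show False using a(1) by auto
  qed
qed auto

section \<open>Lebesgue and Gaussian product measures\<close>

text \<open>Change of variables for a translation followed by a dilation. On boxes it splits into
  the one-dimensional rule in each coordinate, and the factors \<open>c\<close> multiply to the
  Jacobian.\<close>

lemma PiM_lborel_affine:
  fixes a :: "'i \<Rightarrow> real" and c :: real
  assumes "finite I" "c > 0"
  shows "Pi\<^sub>M I (\<lambda>_. lborel) =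
    density (distr (Pi\<^sub>M I (\<lambda>_. lborel)) (Pi\<^sub>M I (\<lambda>_. lborel)) (\<lambda>x. \<lambda>i\<in>I. a i + c * x i))
      (\<lambda>_. ennreal (c ^ card I))" (is "?L = ?R")
proof -
  interpret product_sigma_finite "\<lambda>_ :: 'i. lborel :: real measure" ..
  have "?R = ?L"
  proof (rule PiM_eqI)
    fix A assume A: "\<And>i. i \<in> I \<Longrightarrow> A i \<in> sets (lborel :: real measure)"
    then have box: "Pi\<^sub>E I A \<in> sets ?L" using assms by (intro sets_PiM_I_finite) auto
    have pre: "(\<lambda>x. a i + c * x) -` A i \<in> sets lborel" if "i \<in> I" for i
    proof -
      have "(\<lambda>x. a i + c * x) \<in> borel \<rightarrow>\<^sub>M borel" by measurable
      from measurable_sets[OF this] A[OF that] show ?thesis by simp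
    qed
    have m: "(\<lambda>x. \<lambda>i\<in>I. a i + c * x i) \<in> ?L \<rightarrow>\<^sub>M ?L" by measurable
    have "emeasure ?R (Pi\<^sub>E I A) = ennreal (c ^ card I) * emeasure ?L
        ((\<lambda>x. \<lambda>i\<in>I. a i + c * x i) -` Pi\<^sub>E I A \<inter> space ?L)"
      using box by (simp add: emeasure_density_const emeasure_distr[OF m])
    also have "(\<lambda>x. \<lambda>i\<in>I. a i + c * x i) -` Pi\<^sub>E I A \<inter> space ?L
        = Pi\<^sub>E I (\<lambda>i. (\<lambda>x. a i + c * x) -` A i)"
      by (auto simp: space_PiM PiE_iff)
    also have "emeasure ?L \<dots> = (\<Prod>i\<in>I. emeasure lborel ((\<lambda>x. a i + c * x) -` A i))"
      using assms pre by (intro emeasure_PiM) auto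
    also have "ennreal (c ^ card I) * \<dots>
        = (\<Prod>i\<in>I. ennreal c * emeasure lborel ((\<lambda>x. a i + c * x) -` A i))"
      using assms by (simp add: prod.distrib ennreal_power)
    also have "\<dots> = (\<Prod>i\<in>I. emeasure lborel (A i))"
    proof (rule prod.cong)
      fix i assume "i \<in> I"
      have "emeasure lborel (A i) = emeasure (density (distr lborel borel (\<lambda>x. a i + c * x)) (\<lambda>_. ennreal \<bar>c\<bar>)) (A i)"
        using assms by (subst lborel_real_affine[of c "a i"]) auto
      also have "\<dots> = ennreal c * emeasure lborel ((\<lambda>x. a i + c * x) -` A i)"
        using A[OF \<open>i \<in> I\<close>] assms by (simp add: emeasure_density_const emeasure_distr)
      finally show "ennreal c * emeasure lborel ((\<lambda>x. a i + c * x) -` A i) = emeasure lborel (A i)" ..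
    qed simp
    finally show "emeasure ?R (Pi\<^sub>E I A) = (\<Prod>i\<in>I. emeasure lborel (A i))" .
  qed (use assms in auto)
  then show ?thesis ..
qed

lemma emeasure_PiM_lborel_affine:
  fixes a :: "'i \<Rightarrow> real" and c :: real
  assumes "finite I" "c > 0" "S \<in> sets (Pi\<^sub>M I (\<lambda>_. lborel))"
  shows "emeasure (Pi\<^sub>M I (\<lambda>_. lborel)) S = ennreal (c ^ card I) *
    emeasure (Pi\<^sub>M I (\<lambda>_. lborel)) {x \<in> space (Pi\<^sub>M I (\<lambda>_. lborel)). (\<lambda>i\<in>I. a i + c * x i) \<in> S}"
proof -
  have m: "(\<lambda>x. \<lambda>i\<in>I. a i + c * x i) \<in> Pi\<^sub>M I (\<lambda>_. lborel) \<rightarrow>\<^sub>M Pi\<^sub>M I (\<lambda>_. lborel)"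
    by measurable
  show ?thesis
    by (subst PiM_lborel_affine[OF assms(1,2), of a])
      (use assms(3) in \<open>auto simp: emeasure_density_const emeasure_distr[OF m] vimage_def Int_def conj_commute\<close>)
qed

text \<open>The indicator of a box is a product, so integrating the joint density over a box factors
  into one-dimensional integrals; boxes determine the product measure.\<close>

lemma PiM_density:
  assumes "finite I" "\<And>i. i \<in> I \<Longrightarrow> f i \<in> borel_measurable lborel" "\<And>i. sigma_finite_measure (density lborel (f i))"
  shows "Pi\<^sub>M I (\<lambda>i. density lborel (f i)) = density (Pi\<^sub>M I (\<lambda>_. lborel :: real measure)) (\<lambda>x. \<Prod>i\<in>I. f i (x i))"
    (is "?L = ?R")
proof -
  interpret L: product_sigma_finite "\<lambda>_. lborel :: real measure" ..
  interpret D: product_sigma_finite "\<lambda>i. density lborel (f i)"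
    using assms(3) by (simp add: product_sigma_finite_def)
  have m[measurable]: "(\<lambda>x. \<Prod>i\<in>I. f i (x i)) \<in> borel_measurable (Pi\<^sub>M I (\<lambda>_. lborel))"
  proof (rule borel_measurable_prod_ennreal)
    fix i assume "i \<in> I"
    then show "(\<lambda>x. f i (x i)) \<in> borel_measurable (Pi\<^sub>M I (\<lambda>_. lborel))"
      using assms(2) by (intro measurable_compose[OF measurable_component_singleton]) auto
  qed
  have "?R = ?L"
  proof (rule D.PiM_eqI)
    show "sets ?R = sets ?L" by (simp cong: sets_PiM_cong)
  next
    fix A assume "\<And>i. i \<in> I \<Longrightarrow> A i \<in> sets (density lborel (f i))"
    then have A: "\<And>i. i \<in> I \<Longrightarrow> A i \<in> sets lborel" by simp
    have "emeasure ?R (Pi\<^sub>E I A) = (\<integral>\<^sup>+x. (\<Prod>i\<in>I. f i (x i)) * indicator (Pi\<^sub>E I A) x \<partial>Pi\<^sub>M I (\<lambda>_. lborel))"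
      using A assms by (intro emeasure_density m sets_PiM_I_finite) auto
    also have "\<dots> = (\<integral>\<^sup>+x. (\<Prod>i\<in>I. f i (x i) * indicator (A i) (x i)) \<partial>Pi\<^sub>M I (\<lambda>_. lborel))"
    proof (rule nn_integral_cong)
      fix x assume "x \<in> space (Pi\<^sub>M I (\<lambda>_. lborel :: real measure))"
      then have "indicator (Pi\<^sub>E I A) x = (\<Prod>i\<in>I. indicator (A i) (x i) :: ennreal)"
        using assms(1) by (auto simp: indicator_def space_PiM PiE_iff prod_zero_iff)
      then show "(\<Prod>i\<in>I. f i (x i)) * indicator (Pi\<^sub>E I A) x = (\<Prod>i\<in>I. f i (x i) * indicator (A i) (x i))"
        by (simp add: prod.distrib)
    qed
    also have "\<dots> = (\<Prod>i\<in>I. \<integral>\<^sup>+x. f i x * indicator (A i) x \<partial>lborel)"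
      using assms A by (intro L.product_nn_integral_prod[of I "\<lambda>i x. f i x * indicator (A i) x"]) auto
    also have "\<dots> = (\<Prod>i\<in>I. emeasure (density lborel (f i)) (A i))"
      using assms A by (intro prod.cong) (auto simp: emeasure_density)
    finally show "emeasure ?R (Pi\<^sub>E I A) = (\<Prod>i\<in>I. emeasure (density lborel (f i)) (A i))" .
  qed (use assms in auto)
  then show ?thesis ..
qed

section \<open>The standard Gaussian vector and cones\<close>

definition gauss_vec :: "nat \<Rightarrow> (nat \<Rightarrow> real) measure" where
  "gauss_vec d = Pi\<^sub>M {..<d} (\<lambda>_. density lborel std_normal_density)"

lemma prob_space_gauss_vec: "prob_space (gauss_vec d)"
  unfolding gauss_vec_def by (intro prob_space_PiM prob_space_normal_density) simp

lemma sets_gauss_vec [measurable_cong, simp]: "sets (gauss_vec d) = sets (Pi\<^sub>M {..<d} (\<lambda>_. lborel))"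
  unfolding gauss_vec_def by (intro sets_PiM_cong) auto

lemma space_gauss_vec [simp]: "space (gauss_vec d) = space (Pi\<^sub>M {..<d} (\<lambda>_. lborel))"
  by (intro sets_eq_imp_space_eq) simp

text \<open>The joint density depends on the norm alone. This is why the Gaussian vector can replace
  the uniform direction for events invariant under scaling, while its independent coordinates keep
  the computations one-dimensional.\<close>

lemma gauss_vec_eq_density:
  "gauss_vec d = density (Pi\<^sub>M {..<d} (\<lambda>_. lborel))
     (\<lambda>x. ennreal ((1 / sqrt (2 * pi)) ^ d * exp (- (\<Sum>i<d. (x i)\<^sup>2) / 2)))"
proof -
  have "gauss_vec d = density (Pi\<^sub>M {..<d} (\<lambda>_. lborel)) (\<lambda>x. \<Prod>i<d. ennreal (std_normal_density (x i)))"
    unfolding gauss_vec_def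
    by (rule PiM_density)
       (auto intro!: prob_space_imp_sigma_finite prob_space_normal_density)
  also have "(\<lambda>x. \<Prod>i<d. ennreal (std_normal_density (x i)))
      = (\<lambda>x. ennreal ((1 / sqrt (2 * pi)) ^ d * exp (- (\<Sum>i<d. (x i)\<^sup>2) / 2)))"
    by (simp add: prod_ennreal std_normal_density_def prod.distrib exp_sum power_one_over
        sum_negf sum_divide_distrib prod_dividef flip: exp_sum)
  finally show ?thesis .
qed

text \<open>Dilation by \<open>r\<close> carries the part of the cone inside the unit ball onto the
  part inside the ball of radius \<open>r\<close>, with Jacobian \<open>r ^ d\<close>.\<close>

lemma emeasure_cone_ball:
  assumes S: "S \<in> sets (Pi\<^sub>M {..<d} (\<lambda>_. lborel))"
    and cone: "\<And>x c. c > 0 \<Longrightarrow> x \<in> space (Pi\<^sub>M {..<d} (\<lambda>_. lborel)) \<Longrightarrow> (\<lambda>i\<in>{..<d}. c * x i) \<in> S \<longleftrightarrow> x \<in> S"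
    and "r > 0"
  shows "emeasure (Pi\<^sub>M {..<d} (\<lambda>_. lborel)) {x \<in> S. L2_set x {..<d} \<le> r} =
    ennreal (r ^ d) * emeasure (Pi\<^sub>M {..<d} (\<lambda>_. lborel)) (unit_ball d \<inter> S)"
proof -
  let ?L = "Pi\<^sub>M {..<d} (\<lambda>_. lborel) :: (nat \<Rightarrow> real) measure"
  have sub: "S \<subseteq> space ?L" using S by (rule sets.sets_into_space)
  have norm: "L2_set (\<lambda>i\<in>{..<d}. r * x i) {..<d} = r * L2_set x {..<d}" for x
  proof -
    have "L2_set (\<lambda>i\<in>{..<d}. r * x i) {..<d} = L2_set (\<lambda>i. r * x i) {..<d}"
      by (rule L2_set_cong) auto
    then show ?thesis using \<open>r > 0\<close> by (simp add: L2_set_right_distrib)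
  qed
  have "{x \<in> S. L2_set x {..<d} \<le> r} = S \<inter> {x \<in> space ?L. L2_set x {..<d} \<le> r}"
    using sub by auto
  also have "\<dots> \<in> sets ?L" using S unfolding L2_set_def by measurable
  finally have "emeasure ?L {x \<in> S. L2_set x {..<d} \<le> r} = ennreal (r ^ d) *
      emeasure ?L {x \<in> space ?L. (\<lambda>i\<in>{..<d}. 0 + r * x i) \<in> {x \<in> S. L2_set x {..<d} \<le> r}}"
    using emeasure_PiM_lborel_affine[of "{..<d}" r "{x \<in> S. L2_set x {..<d} \<le> r}" "\<lambda>_. 0"] \<open>r > 0\<close>
    by simp
  also have "{x \<in> space ?L. (\<lambda>i\<in>{..<d}. 0 + r * x i) \<in> {x \<in> S. L2_set x {..<d} \<le> r}} = unit_ball d \<inter> S"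
    using sub \<open>r > 0\<close> by (auto simp: cone norm unit_ball_def)
  finally show ?thesis .
qed

text \<open>The density of the Gaussian vector is a mixture of indicators of centred balls, each of
  which gives a cone the proportion that the unit ball gives it.\<close>

lemma emeasure_cone_gauss_vec:
  assumes S: "S \<in> sets (Pi\<^sub>M {..<d} (\<lambda>_. lborel))"
    and cone: "\<And>x c. c > 0 \<Longrightarrow> x \<in> space (Pi\<^sub>M {..<d} (\<lambda>_. lborel)) \<Longrightarrow> (\<lambda>i\<in>{..<d}. c * x i) \<in> S \<longleftrightarrow> x \<in> S"
  shows "emeasure (uniform_measure (Pi\<^sub>M {..<d} (\<lambda>_. lborel)) (unit_ball d)) S = emeasure (gauss_vec d) S"
proof -
  let ?L = "Pi\<^sub>M {..<d} (\<lambda>_. lborel) :: (nat \<Rightarrow> real) measure"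
  interpret product_sigma_finite "\<lambda>_ :: nat. lborel :: real measure" ..
  interpret L: sigma_finite_measure ?L by (rule sigma_finite) simp
  interpret P: pair_sigma_finite "lborel :: real measure" ?L by standard
  define C where "C = (1 / sqrt (2 * pi)) ^ d"
  \<comment> \<open>\<open>r s\<close> is the radius of the ball on which
    \<open>exp (- |x|^2 / 2)\<close> is at least \<open>s\<close>. The factor \<open>K\<close>
    defined next is the same for all cones and is identified only at the end.\<close>
  define r where "r s = sqrt (- 2 * ln s)" for s
  define K where "K = ennreal C * (\<integral>\<^sup>+s. indicator {0<..<1} s * ennreal (r s ^ d) \<partial>lborel)"
  have C: "C \<ge> 0" by (simp add: C_def)
  \<comment> \<open>Layer-cake formula: the value \<open>exp (- q / 2)\<close> is the length of the
    set of levels below it. Requiring \<open>s < 1\<close> keeps \<open>r s\<close> positive and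
    costs at most one point.\<close>
  have level: "emeasure lborel {s. 0 < s \<and> s < 1 \<and> s \<le> exp (- q / 2)} = ennreal (exp (- q / 2))"
    if "0 \<le> q" for q :: real
  proof (cases "q = 0")
    case True
    then have "{s. 0 < s \<and> s < 1 \<and> s \<le> exp (- q / 2)} = {0<..<1::real}" by auto
    then show ?thesis using True by simp
  next
    case False
    then have "exp (- q / 2) < 1" using that by simp
    then have "{s. 0 < s \<and> s < 1 \<and> s \<le> exp (- q / 2)} = {0<..exp (- q / 2)}"
      by (intro set_eqI) (auto simp del: exp_less_one_iff minus_divide_left[symmetric] intro: order.strict_trans1)
    then show ?thesis by simp
  qed
  have le_iff: "s \<le> exp (- (\<Sum>i<d. (x i)\<^sup>2) / 2) \<longleftrightarrow> L2_set x {..<d} \<le> r s" if "0 < s" for s x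
  proof -
    have "s \<le> exp (- (\<Sum>i<d. (x i)\<^sup>2) / 2) \<longleftrightarrow> ln s \<le> - (\<Sum>i<d. (x i)\<^sup>2) / 2"
      using that by (metis exp_le_cancel_iff exp_ln)
    then show ?thesis by (auto simp: r_def L2_set_def)
  qed
  have K: "emeasure (gauss_vec d) S = K * emeasure ?L (unit_ball d \<inter> S)"
    if S: "S \<in> sets ?L"
    and cone: "\<And>x c. c > 0 \<Longrightarrow> x \<in> space ?L \<Longrightarrow> (\<lambda>i\<in>{..<d}. c * x i) \<in> S \<longleftrightarrow> x \<in> S" for S
  proof -
    have [measurable]: "S \<in> sets ?L" by fact
    have "emeasure (gauss_vec d) S
        = (\<integral>\<^sup>+x. ennreal C * ennreal (exp (- (\<Sum>i<d. (x i)\<^sup>2) / 2)) * indicator S x \<partial>?L)"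
      unfolding gauss_vec_eq_density by (simp add: emeasure_density C_def ennreal_mult)
    also have "\<dots> = (\<integral>\<^sup>+x. (\<integral>\<^sup>+s. ennreal C *
        (indicator {s. 0 < s \<and> s < 1 \<and> s \<le> exp (- (\<Sum>i<d. (x i)\<^sup>2) / 2)} s * indicator S x) \<partial>lborel) \<partial>?L)"
      by (intro nn_integral_cong)
        (simp add: nn_integral_cmult nn_integral_multc level[simplified] sum_nonneg mult.assoc)
    also have "\<dots> = (\<integral>\<^sup>+s. (\<integral>\<^sup>+x. ennreal C *
        (indicator {s. 0 < s \<and> s < 1 \<and> s \<le> exp (- (\<Sum>i<d. (x i)\<^sup>2) / 2)} s * indicator S x) \<partial>?L) \<partial>lborel)"
    proof (rule P.Fubini')
      have [measurable]: "(\<lambda>z. indicator S (snd z) :: ennreal) \<in> borel_measurable (lborel \<Otimes>\<^sub>M ?L)"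
        by (rule measurable_compose[OF measurable_snd]) measurable
      have [measurable]: "(\<lambda>z. indicator {s. 0 < s \<and> s < 1 \<and> s \<le> exp (- (\<Sum>i<d. (snd z i)\<^sup>2) / 2)} (fst z) :: ennreal)
          \<in> borel_measurable (lborel \<Otimes>\<^sub>M ?L)"
      proof -
        have [measurable]: "(\<lambda>z. \<Sum>i<d. (snd z i)\<^sup>2) \<in> borel_measurable (lborel \<Otimes>\<^sub>M ?L)"
          by (intro measurable_compose[OF measurable_snd]) measurable
        have "(\<lambda>z. if 0 < fst z \<and> fst z < 1 \<and> fst z \<le> exp (- (\<Sum>i<d. (snd z i)\<^sup>2) / 2) then 1 else 0 :: ennreal)
          \<in> borel_measurable (lborel \<Otimes>\<^sub>M ?L)" by measurable
        then show ?thesis by (simp add: indicator_def of_bool_def)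
      qed
      show "(\<lambda>(s, x). ennreal C * (indicator {s. 0 < s \<and> s < 1 \<and> s \<le> exp (- (\<Sum>i<d. (x i)\<^sup>2) / 2)} s
          * indicator S x)) \<in> borel_measurable (lborel \<Otimes>\<^sub>M ?L)"
        unfolding case_prod_beta by measurable
    qed
    also have "\<dots> = (\<integral>\<^sup>+s. ennreal C * (indicator {0<..<1} s * ennreal (r s ^ d)) *
        emeasure ?L (unit_ball d \<inter> S) \<partial>lborel)"
    proof (rule nn_integral_cong)
      fix s :: real
      show "(\<integral>\<^sup>+x. ennreal C *
        (indicator {s. 0 < s \<and> s < 1 \<and> s \<le> exp (- (\<Sum>i<d. (x i)\<^sup>2) / 2)} s * indicator S x) \<partial>?L)
        = ennreal C * (indicator {0<..<1} s * ennreal (r s ^ d)) * emeasure ?L (unit_ball d \<inter> S)"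
      proof (cases "0 < s \<and> s < 1")
        case True
        then have r: "r s > 0" by (simp add: r_def)
        have "(\<integral>\<^sup>+x. ennreal C *
          (indicator {s. 0 < s \<and> s < 1 \<and> s \<le> exp (- (\<Sum>i<d. (x i)\<^sup>2) / 2)} s * indicator S x) \<partial>?L)
          = (\<integral>\<^sup>+x. ennreal C * indicator {x \<in> S. L2_set x {..<d} \<le> r s} x \<partial>?L)"
          using True le_iff by (intro nn_integral_cong) (auto simp: indicator_def)
        also have "\<dots> = ennreal C * emeasure ?L {x \<in> S. L2_set x {..<d} \<le> r s}"
        proof -
          have "{x \<in> S. L2_set x {..<d} \<le> r s} = S \<inter> {x \<in> space ?L. L2_set x {..<d} \<le> r s}"
            using sets.sets_into_space[OF S] by auto
          also have "\<dots> \<in> sets ?L" unfolding L2_set_def by measurable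
          finally show ?thesis by (simp add: nn_integral_cmult_indicator)
        qed
        also have "emeasure ?L {x \<in> S. L2_set x {..<d} \<le> r s}
            = ennreal (r s ^ d) * emeasure ?L (unit_ball d \<inter> S)"
          by (rule emeasure_cone_ball[OF S cone r])
        finally show ?thesis using True by (simp add: mult.assoc)
      qed auto
    qed
    also have "\<dots> = K * emeasure ?L (unit_ball d \<inter> S)"
      unfolding K_def r_def by (simp add: nn_integral_multc nn_integral_cmult)
    finally show ?thesis .
  qed
  have V: "emeasure ?L (unit_ball d) \<noteq> 0" "emeasure ?L (unit_ball d) \<noteq> \<infinity>"
    using unit_ball_vol_pos[of "real d", OF of_nat_0_le_iff] by (auto simp: emeasure_unit_ball ennreal_eq_0_iff not_le)
  \<comment> \<open>The whole space is a cone of Gaussian mass 1, which identifies \<open>K\<close>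
    as the reciprocal of the volume of the unit ball.\<close>
  have "unit_ball d \<inter> space ?L = unit_ball d" by (auto simp: unit_ball_def)
  moreover have "emeasure (gauss_vec d) (space ?L) = 1"
    using prob_space.emeasure_space_1[OF prob_space_gauss_vec[of d]] by simp
  ultimately have "K * emeasure ?L (unit_ball d) = 1"
    using K[of "space ?L"] by (simp add: space_PiM PiE_iff)
  then have "K = 1 / emeasure ?L (unit_ball d)"
    using V by (metis ennreal_mult_divide_eq infinity_ennreal_def mult.commute)
  then show ?thesis
    using K[OF S cone] S by (simp add: emeasure_uniform_measure divide_ennreal_def mult.commute)
qed

section \<open>Separation probabilities\<close>

text \<open>A sum of independent centred normal variables is normal, with the variances added.
  Coordinates with \<open>v i = 0\<close> are dropped first, as the summation rule asks for positive
  standard deviations.\<close>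

lemma distributed_linear_form:
  fixes v :: "nat \<Rightarrow> real"
  assumes "\<exists>i<k. v i \<noteq> 0"
  shows "distributed (gauss_vec k) lborel (\<lambda>y. \<Sum>i<k. v i * y i) (normal_density 0 (L2_set v {..<k}))"
proof -
  interpret prob_space "gauss_vec k" by (rule prob_space_gauss_vec)
  let ?N = "density lborel std_normal_density :: real measure"
  let ?I = "{i \<in> {..<k}. v i \<noteq> 0}"
  have coord: "(\<lambda>y. y i) \<in> gauss_vec k \<rightarrow>\<^sub>M borel" if "i < k" for i
  proof -
    have "(\<lambda>y. y i) \<in> Pi\<^sub>M {..<k} (\<lambda>_. lborel :: real measure) \<rightarrow>\<^sub>M lborel"
      using that by (intro measurable_component_singleton) simp
    then show ?thesis by (simp cong: measurable_cong_sets)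
  qed
  have distr: "distr (gauss_vec k) borel (\<lambda>y. y i) = ?N" if "i < k" for i
  proof -
    have "distr (gauss_vec k) borel (\<lambda>y. y i) = distr (gauss_vec k) ?N (\<lambda>y. y i)"
      by (intro distr_cong) auto
    also have "\<dots> = ?N"
      unfolding gauss_vec_def using that
      by (intro distr_PiM_component prob_space_normal_density) auto
    finally show ?thesis .
  qed
  have indep: "indep_vars (\<lambda>_. borel) (\<lambda>i y. y i) {..<k}"
  proof (subst indep_vars_iff_distr_eq_PiM')
    have "distr (gauss_vec k) (Pi\<^sub>M {..<k} (\<lambda>_. borel)) (\<lambda>x. \<lambda>i\<in>{..<k}. x i) =
        distr (gauss_vec k) (gauss_vec k) (\<lambda>x. x)"
      by (intro distr_cong)
        (auto simp: space_PiM PiE_iff extensional_def restrict_def fun_eq_iff cong: sets_PiM_cong)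
    also have "\<dots> = gauss_vec k" by simp
    also have "\<dots> = Pi\<^sub>M {..<k} (\<lambda>_. ?N)" by (simp add: gauss_vec_def)
    also have "\<dots> = (\<Pi>\<^sub>M i\<in>{..<k}. distr (gauss_vec k) borel (\<lambda>y. y i))"
      by (intro PiM_cong refl distr[symmetric]) simp
    finally show "distr (gauss_vec k) (Pi\<^sub>M {..<k} (\<lambda>_. borel)) (\<lambda>x. \<lambda>i\<in>{..<k}. x i) =
        (\<Pi>\<^sub>M i\<in>{..<k}. distr (gauss_vec k) borel (\<lambda>y. y i))" .
  qed (use assms coord in auto)
  have "indep_vars (\<lambda>_. borel) (\<lambda>i y. v i * y i) ?I"
    by (rule indep_vars_compose2[OF indep_vars_subset[OF indep]]) auto
  moreover have "distributed (gauss_vec k) lborel (\<lambda>y. v i * y i) (normal_density 0 \<bar>v i\<bar>)" if "i \<in> ?I" for i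
  proof -
    have "distributed (gauss_vec k) lborel (\<lambda>y. y i) std_normal_density"
      using that distr[of i] by (auto simp: distributed_def coord cong: distr_cong)
    from normal_density_affine[OF this, of "v i" 0] that show ?thesis by simp
  qed
  ultimately have "distributed (gauss_vec k) lborel (\<lambda>y. \<Sum>i\<in>?I. v i * y i)
      (normal_density (\<Sum>i\<in>?I. 0) (sqrt (\<Sum>i\<in>?I. \<bar>v i\<bar>\<^sup>2)))"
    using assms by (intro sum_indep_normal) auto
  moreover have "(\<Sum>i\<in>?I. v i * y i) = (\<Sum>i<k. v i * y i)" for y
    by (rule sum.mono_neutral_left) auto
  moreover have "(\<Sum>i\<in>?I. \<bar>v i\<bar>\<^sup>2) = (\<Sum>i<k. (v i)\<^sup>2)"
    unfolding power2_abs by (rule sum.mono_neutral_left) auto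
  ultimately show ?thesis by (simp add: L2_set_def)
qed

text \<open>Chebyshev's inequality for a centred variable of variance at most 1. The form 0 is
  treated apart because it has no normal density.\<close>

lemma prob_linear_form_tail:
  assumes "L2_set v {..<k} \<le> 1"
  shows "measure (gauss_vec k) {y \<in> space (gauss_vec k). 10 \<le> \<bar>\<Sum>i<k. v i * y i\<bar>} \<le> 1 / 100"
proof (cases "\<exists>i<k. v i \<noteq> 0")
  case True
  interpret prob_space "gauss_vec k" by (rule prob_space_gauss_vec)
  let ?Z = "\<lambda>y. \<Sum>i<k. v i * y i" and ?\<sigma> = "L2_set v {..<k}"
  have D: "distributed (gauss_vec k) lborel ?Z (normal_density 0 ?\<sigma>)"
    by (rule distributed_linear_form[OF True])
  have \<sigma>: "?\<sigma> > 0" using True by (auto simp: L2_set_def intro!: sum_pos2)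
  have "integrable lborel (\<lambda>x. normal_density 0 ?\<sigma> x * x ^ 2)"
    using integrable_normal_moment[OF \<sigma>, of 0 2] by simp
  then have "integrable (gauss_vec k) (\<lambda>y. ?Z y ^ 2)"
    by (subst distributed_integrable[OF D, symmetric]) auto
  then have "prob {y \<in> space (gauss_vec k). 10 \<le> \<bar>?Z y - expectation ?Z\<bar>} \<le> variance ?Z / 10\<^sup>2"
    by (intro Chebyshev_inequality) auto
  also have "\<dots> = ?\<sigma>\<^sup>2 / 100" by (simp add: normal_distributed_variance[OF \<sigma> D])
  also have "\<dots> \<le> 1 / 100" using assms \<sigma> by (simp add: power_le_one)
  finally show ?thesis by (simp add: normal_distributed_expectation[OF \<sigma> D])
next
  case False
  then have "(\<Sum>i<k. v i * y i) = 0" for y by simp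
  then show ?thesis by simp
qed

text \<open>On the interval from \<open>\<sigma> / 2\<close> to \<open>\<sigma>\<close>, of length
  \<open>\<sigma> / 2\<close>, the normal density is at least \<open>1 / (6 * \<sigma>)\<close>: the
  exponential is at least 1/2 there, and \<open>sqrt (2 * pi) \<le> 3\<close>.\<close>

lemma prob_linear_form_ge:
  assumes "0 < L2_set v {..<k}"
  shows "1 / 12 \<le> measure (gauss_vec k) {y \<in> space (gauss_vec k). L2_set v {..<k} / 2 \<le> (\<Sum>i<k. v i * y i)}"
proof -
  interpret prob_space "gauss_vec k" by (rule prob_space_gauss_vec)
  let ?Z = "\<lambda>y. \<Sum>i<k. v i * y i"
  define \<sigma> where "\<sigma> = L2_set v {..<k}"
  have \<sigma>: "\<sigma> > 0" using assms by (simp add: \<sigma>_def)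
  have "\<exists>i<k. v i \<noteq> 0" using assms by (rule contrapos_pp) (auto simp: L2_set_def)
  then have D: "distributed (gauss_vec k) lborel ?Z (normal_density 0 \<sigma>)"
    unfolding \<sigma>_def by (rule distributed_linear_form)
  have dens: "1 / (6 * \<sigma>) \<le> normal_density 0 \<sigma> x" if "x \<in> {\<sigma> / 2..\<sigma>}" for x
  proof -
    have "x\<^sup>2 \<le> \<sigma>\<^sup>2" using that \<sigma> by (intro power_mono) auto
    then have "1 / 2 \<le> 1 - x\<^sup>2 / (2 * \<sigma>\<^sup>2)" using \<sigma> by (simp add: field_simps)
    also have "\<dots> \<le> exp (- x\<^sup>2 / (2 * \<sigma>\<^sup>2))" using exp_ge_add_one_self[of "- x\<^sup>2 / (2 * \<sigma>\<^sup>2)"] by simp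
    finally have e: "1 / 2 \<le> exp (- x\<^sup>2 / (2 * \<sigma>\<^sup>2))" .
    have "2 * pi * \<sigma>\<^sup>2 \<le> 9 * \<sigma>\<^sup>2" using pi_less_4 by (intro mult_right_mono) auto
    then have "2 * pi * \<sigma>\<^sup>2 \<le> (3 * \<sigma>)\<^sup>2" by (simp add: power_mult_distrib)
    then have "sqrt (2 * pi * \<sigma>\<^sup>2) \<le> 3 * \<sigma>" using \<sigma> by (simp add: real_le_lsqrt)
    then have "1 / (3 * \<sigma>) \<le> 1 / sqrt (2 * pi * \<sigma>\<^sup>2)" using \<sigma> by (intro divide_left_mono) auto
    then have "1 / (3 * \<sigma>) * (1 / 2) \<le> 1 / sqrt (2 * pi * \<sigma>\<^sup>2) * exp (- x\<^sup>2 / (2 * \<sigma>\<^sup>2))"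
      using e \<sigma> by (intro mult_mono) auto
    then show ?thesis by (simp add: normal_density_def)
  qed
  have "ennreal (1 / 12) = (\<integral>\<^sup>+x. ennreal (1 / (6 * \<sigma>)) * indicator {\<sigma> / 2..\<sigma>} x \<partial>lborel)"
    using \<sigma> by (simp add: nn_integral_cmult_indicator field_simps flip: ennreal_mult)
  also have "\<dots> \<le> (\<integral>\<^sup>+x. ennreal (normal_density 0 \<sigma> x) * indicator {\<sigma> / 2..} x \<partial>lborel)"
    using dens by (intro nn_integral_mono) (auto simp: indicator_def intro: ennreal_leI)
  also have "\<dots> = emeasure (gauss_vec k) (?Z -` {\<sigma> / 2..} \<inter> space (gauss_vec k))"
    by (rule distributed_emeasure[OF D, symmetric]) simp
  also have "?Z -` {\<sigma> / 2..} \<inter> space (gauss_vec k) = {y \<in> space (gauss_vec k). \<sigma> / 2 \<le> ?Z y}" by auto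
  finally show ?thesis by (simp add: emeasure_eq_measure \<sigma>_def)
qed

text \<open>With probability at least \<open>1/20\<close> the first \<open>k\<close> Gaussian coordinates \<open>y\<close> satisfy
  \<open>\<bar>u \<bullet> y\<bar>, \<bar>v \<bullet> y\<bar> < 10\<close> and \<open>(u - v) \<bullet> y \<ge> \<sigma> / 2\<close>, where \<open>\<sigma>\<close> is the distance of \<open>u\<close> and \<open>v\<close>;
  the last coordinate then separates on an interval of length \<open>\<sigma> / 2\<close> inside \<open>[-10, 10]\<close>.\<close>

definition sep_const :: real where
  "sep_const = std_normal_density 10 / 40"

lemma sep_const_pos: "0 < sep_const"
  by (simp add: sep_const_def std_normal_density_def)

lemma gauss_separation:
  assumes "L2_set u {..<k} \<le> 1" "L2_set v {..<k} \<le> 1"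
  shows "sep_const * L2_set (\<lambda>i. u i - v i) {..<k}
    \<le> measure (gauss_vec (Suc k)) {x \<in> space (gauss_vec (Suc k)). pos_side k u x \<and> \<not> pos_side k v x}"
    (is "_ \<le> measure _ ?S")
proof (cases "L2_set (\<lambda>i. u i - v i) {..<k} = 0")
  case False
  define \<sigma> where "\<sigma> = L2_set (\<lambda>i. u i - v i) {..<k}"
  have \<sigma>: "\<sigma> > 0" using False L2_set_nonneg[of "\<lambda>i. u i - v i" "{..<k}"] unfolding \<sigma>_def by linarith
  let ?N = "density lborel std_normal_density :: real measure"
  let ?G = "gauss_vec k"
  interpret G: prob_space ?G by (rule prob_space_gauss_vec)
  interpret G': prob_space "gauss_vec (Suc k)" by (rule prob_space_gauss_vec)
  interpret N: product_sigma_finite "\<lambda>_ :: nat. ?N"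
    by (simp add: product_sigma_finite_def prob_space_imp_sigma_finite prob_space_normal_density)
  have S: "?S \<in> sets (gauss_vec (Suc k))"
    unfolding pos_side_def by measurable
  define E where "E = {y \<in> space ?G. \<sigma> / 2 \<le> (\<Sum>i<k. (u i - v i) * y i)}"
  define T where "T w = {y \<in> space ?G. 10 \<le> \<bar>\<Sum>i<k. w i * y i\<bar>}" for w
  have [measurable, simp]: "E \<in> sets (Pi\<^sub>M {..<k} (\<lambda>_. lborel))" "T w \<in> sets (Pi\<^sub>M {..<k} (\<lambda>_. lborel))" for w
    unfolding E_def T_def space_gauss_vec by measurable
  \<comment> \<open>The two tails are removed from \<open>E\<close>, and
    \<open>1/12 - 1/100 - 1/100\<close> exceeds \<open>1/20\<close>.\<close>
  have "1 / 12 \<le> measure ?G E"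
    using prob_linear_form_ge[of "\<lambda>i. u i - v i" k] \<sigma> by (simp add: E_def \<sigma>_def)
  moreover have "measure ?G (T u) \<le> 1 / 100" "measure ?G (T v) \<le> 1 / 100"
    using prob_linear_form_tail assms by (auto simp: T_def)
  moreover have "measure ?G E \<le> measure ?G (E - T u - T v) + measure ?G (T u \<union> T v)"
    by (rule order.trans[OF G.finite_measure_mono measure_Un_le]) auto
  moreover have "measure ?G (T u \<union> T v) \<le> measure ?G (T u) + measure ?G (T v)"
    by (rule measure_Un_le) auto
  ultimately have good: "1 / 20 \<le> measure ?G (E - T u - T v)" by simp
  have slice: "ennreal (\<sigma> / 2 * std_normal_density 10) \<le> emeasure ?N {t. y(k := t) \<in> ?S}"
    if y: "y \<in> E - T u - T v" for y
  proof -
    define a b where "a = (\<Sum>i<k. u i * y i)" and "b = (\<Sum>i<k. v i * y i)"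
    have "a - b = (\<Sum>i<k. (u i - v i) * y i)" by (simp add: a_def b_def sum_subtractf left_diff_distrib)
    then have ab: "\<sigma> / 2 \<le> a - b" "\<bar>a\<bar> < 10" "\<bar>b\<bar> < 10"
      using y by (auto simp: E_def T_def a_def b_def)
    have sp: "y(k := t) \<in> space (gauss_vec (Suc k))" for t
      using y by (auto simp: E_def space_PiM PiE_iff extensional_def lessThan_Suc)
    have "{t. y(k := t) \<in> ?S} = {- a..< - b}"
      using sp by (auto simp: pos_side_def a_def b_def)
    moreover have "ennreal (\<sigma> / 2 * std_normal_density 10) \<le> emeasure ?N {- a..< - b}"
    proof -
      have "std_normal_density 10 \<le> std_normal_density t" if "t \<in> {- a..<- b}" for t
      proof -
        have "\<bar>t\<bar> \<le> 10" using that ab by auto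
        then have "t\<^sup>2 \<le> 10\<^sup>2" by (metis abs_le_square_iff abs_numeral)
        then show ?thesis by (simp add: std_normal_density_def divide_right_mono)
      qed
      then have "(\<integral>\<^sup>+t. ennreal (std_normal_density 10) * indicator {- a..<- b} t \<partial>lborel)
          \<le> (\<integral>\<^sup>+t. ennreal (std_normal_density t) * indicator {- a..<- b} t \<partial>lborel)"
        by (intro nn_integral_mono) (auto simp: indicator_def intro: ennreal_leI)
      also have "\<dots> = emeasure ?N {- a..<- b}" by (simp add: emeasure_density)
      finally have "ennreal (std_normal_density 10 * (a - b)) \<le> emeasure ?N {- a..<- b}"
        using ab \<sigma> by (simp add: nn_integral_cmult_indicator ennreal_mult)
      moreover have "\<sigma> / 2 * std_normal_density 10 \<le> std_normal_density 10 * (a - b)"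
        using ab by (subst mult.commute) (intro mult_left_mono, auto)
      ultimately show ?thesis by (meson ennreal_leI order.trans)
    qed
    ultimately show ?thesis by simp
  qed
  have "ennreal (sep_const * \<sigma>) \<le> ennreal (\<sigma> / 2 * std_normal_density 10) * emeasure ?G (E - T u - T v)"
  proof -
    \<comment> \<open>The 40 in \<open>sep_const\<close> is 20, from the probability of a good
      \<open>y\<close>, times 2, from the interval length \<open>\<sigma> / 2\<close>.\<close>
    have "sep_const * \<sigma> = \<sigma> / 2 * std_normal_density 10 * (1 / 20)" by (simp add: sep_const_def)
    also have "\<dots> \<le> \<sigma> / 2 * std_normal_density 10 * measure ?G (E - T u - T v)"
      using good \<sigma> by (intro mult_left_mono) auto
    finally show ?thesis using \<sigma> by (simp add: G.emeasure_eq_measure ennreal_leI flip: ennreal_mult)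
  qed
  also have "\<dots> = (\<integral>\<^sup>+y. ennreal (\<sigma> / 2 * std_normal_density 10) * indicator (E - T u - T v) y \<partial>?G)"
    by (simp add: nn_integral_cmult_indicator)
  also have "\<dots> \<le> (\<integral>\<^sup>+y. (\<integral>\<^sup>+t. indicator ?S (y(k := t)) \<partial>?N) \<partial>?G)"
  proof (rule nn_integral_mono)
    fix y assume "y \<in> space ?G"
    then have "y(k := t) \<in> space (gauss_vec (Suc k))" for t
      by (auto simp: space_PiM PiE_iff extensional_def lessThan_Suc)
    then have sets: "{t. y(k := t) \<in> ?S} \<in> sets ?N"
      by (auto simp: pos_side_def)
    have "(\<integral>\<^sup>+t. indicator ?S (y(k := t)) \<partial>?N) = (\<integral>\<^sup>+t. indicator {t. y(k := t) \<in> ?S} t \<partial>?N)"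
      by (intro nn_integral_cong) (simp only: indicator_def mem_Collect_eq)
    also have "\<dots> = emeasure ?N {t. y(k := t) \<in> ?S}"
      by (rule nn_integral_indicator[OF sets])
    finally have "(\<integral>\<^sup>+t. indicator ?S (y(k := t)) \<partial>?N) = emeasure ?N {t. y(k := t) \<in> ?S}" .
    then show "ennreal (\<sigma> / 2 * std_normal_density 10) * indicator (E - T u - T v) y
        \<le> (\<integral>\<^sup>+t. indicator ?S (y(k := t)) \<partial>?N)"
      using slice[of y] by (simp add: indicator_def)
  qed
  also have "\<dots> = integral\<^sup>N (Pi\<^sub>M (insert k {..<k}) (\<lambda>_. ?N)) (indicator ?S)"
    unfolding gauss_vec_def
    by (rule N.product_nn_integral_insert[symmetric])
      (use S in \<open>auto simp: gauss_vec_def lessThan_Suc\<close>)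
  also have "\<dots> = emeasure (gauss_vec (Suc k)) ?S"
    using S by (simp add: gauss_vec_def lessThan_Suc)
  finally show ?thesis
    using sep_const_pos \<sigma> by (simp add: G'.emeasure_eq_measure \<sigma>_def)
qed simp

text \<open>Positive scaling preserves the sign; for the null vector, division by 0 returns the null
  vector again.\<close>

lemma pos_side_normalize_vec: "pos_side k u (normalize_vec (Suc k) x) \<longleftrightarrow> pos_side k u x"
proof (cases "L2_set x {..<Suc k} = 0")
  case True
  then have "x i = 0" if "i < Suc k" for i
    using that by (simp add: L2_set_eq_0_iff)
  then show ?thesis by (simp add: pos_side_def normalize_vec_def)
next
  case False
  define r where "r = L2_set x {..<Suc k}"
  have r: "r > 0" using False L2_set_nonneg[of x "{..<Suc k}"] unfolding r_def by linarith
  have "normalize_vec (Suc k) x k + (\<Sum>i<k. u i * normalize_vec (Suc k) x i) = (x k + (\<Sum>i<k. u i * x i)) / r"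
    by (simp add: normalize_vec_def r_def add_divide_distrib sum_divide_distrib)
  then show ?thesis using r by (simp add: pos_side_def zero_le_divide_iff)
qed

text \<open>The separating event is a cone: normalisation leaves it unchanged, and the unit ball and
  the Gaussian vector give it the same probability. The Gaussian bound therefore carries over to the
  sphere.\<close>

lemma sphere_separation:
  assumes "L2_set u {..<k} \<le> 1" "L2_set v {..<k} \<le> 1"
  shows "ennreal (sep_const * L2_set (\<lambda>i. u i - v i) {..<k})
    \<le> emeasure (uniform_sphere (Suc k)) {x \<in> space (uniform_sphere (Suc k)). pos_side k u x \<and> \<not> pos_side k v x}"
proof -
  let ?L = "Pi\<^sub>M {..<Suc k} (\<lambda>_. lborel) :: (nat \<Rightarrow> real) measure"
  let ?P = "\<lambda>x. pos_side k u x \<and> \<not> pos_side k v x"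
  interpret G: prob_space "gauss_vec (Suc k)" by (rule prob_space_gauss_vec)
  have sp: "space (uniform_sphere (Suc k)) = space (euclidean_borel (Suc k))"
    by (rule sets_eq_imp_space_eq) simp
  have [measurable]: "Measurable.pred (euclidean_borel (Suc k)) ?P"
    unfolding pos_side_def by measurable
  have [measurable]: "Measurable.pred ?L ?P"
    unfolding pos_side_def by measurable
  have "emeasure (uniform_sphere (Suc k)) {x \<in> space (uniform_sphere (Suc k)). ?P x} =
      emeasure (uniform_measure ?L (unit_ball (Suc k))) (normalize_vec (Suc k) -` {x \<in> space (euclidean_borel (Suc k)). ?P x} \<inter> space ?L)"
    unfolding sp unfolding uniform_sphere_def
    by (subst emeasure_distr) auto
  also have "normalize_vec (Suc k) -` {x \<in> space (euclidean_borel (Suc k)). ?P x} \<inter> space ?L = {x \<in> space ?L. ?P x}"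
    using measurable_space[OF measurable_normalize_vec, of _ "Suc k"] by (auto simp: pos_side_normalize_vec)
  also have "emeasure (uniform_measure ?L (unit_ball (Suc k))) {x \<in> space ?L. ?P x} =
      emeasure (gauss_vec (Suc k)) {x \<in> space ?L. ?P x}"
  proof (rule emeasure_cone_gauss_vec)
    fix x c assume c: "(c :: real) > 0" and x: "x \<in> space ?L"
    have "pos_side k w (\<lambda>i\<in>{..<Suc k}. c * x i) \<longleftrightarrow> pos_side k w x" for w
    proof -
      have "(\<Sum>i<k. w i * (c * x i)) = c * (\<Sum>i<k. w i * x i)" by (simp add: sum_distrib_left mult_ac)
      then have "pos_side k w (\<lambda>i\<in>{..<Suc k}. c * x i) \<longleftrightarrow> 0 \<le> c * (x k + (\<Sum>i<k. w i * x i))"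
        by (simp add: pos_side_def distrib_left)
      then show ?thesis using c by (simp add: pos_side_def zero_le_mult_iff)
    qed
    then show "(\<lambda>i\<in>{..<Suc k}. c * x i) \<in> {x \<in> space ?L. ?P x} \<longleftrightarrow> x \<in> {x \<in> space ?L. ?P x}"
      using x by (simp add: space_PiM)
  qed measurable
  finally show ?thesis
    using gauss_separation[OF assms] by (simp add: G.emeasure_eq_measure ennreal_leI)
qed

section \<open>The uniform prior on the unit ball\<close>

definition prior :: "nat \<Rightarrow> (nat \<Rightarrow> real) measure" where
  "prior k = uniform_measure (Pi\<^sub>M {..<k} (\<lambda>_. lborel)) (unit_ball k)"

lemma prob_space_prior: "prob_space (prior k)"
  unfolding prior_def using unit_ball_vol_pos[of "real k", OF of_nat_0_le_iff]
  by (intro prob_space_uniform_measure) (simp_all add: emeasure_unit_ball ennreal_eq_0_iff not_le)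

lemma sets_prior [measurable_cong, simp]: "sets (prior k) = sets (Pi\<^sub>M {..<k} (\<lambda>_. lborel))"
  by (simp add: prior_def)

lemma space_prior [simp]: "space (prior k) = space (Pi\<^sub>M {..<k} (\<lambda>_. lborel))"
  by (simp add: prior_def)

lemma AE_prior: "AE u in prior k. L2_set u {..<k} \<le> 1"
  unfolding prior_def by (rule AE_uniform_measureI[OF unit_ball_sets]) (auto simp: unit_ball_def)

text \<open>A ball of radius \<open>\<rho>\<close> has \<open>\<rho> ^ k\<close> times the volume of
  the unit ball, and the prior only counts its part inside the unit ball. Spreading the prior over
  the ball instead of a sphere reduces the estimate to this volume ratio.\<close>

lemma prior_small_ball:
  assumes "\<rho> > 0"
  shows "emeasure (prior k) {v \<in> space (prior k). L2_set (\<lambda>i. u i - v i) {..<k} \<le> \<rho>} \<le> ennreal (\<rho> ^ k)"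
proof -
  let ?L = "Pi\<^sub>M {..<k} (\<lambda>_. lborel) :: (nat \<Rightarrow> real) measure"
  define A where "A = {v \<in> space ?L. L2_set (\<lambda>i. u i - v i) {..<k} \<le> \<rho>}"
  have A [measurable]: "A \<in> sets ?L" unfolding A_def L2_set_def by measurable
  have "emeasure ?L A = ennreal (\<rho> ^ k) * emeasure ?L {x \<in> space ?L. (\<lambda>i\<in>{..<k}. u i + \<rho> * x i) \<in> A}"
    using emeasure_PiM_lborel_affine[OF _ assms A, of u] by simp
  also have "{x \<in> space ?L. (\<lambda>i\<in>{..<k}. u i + \<rho> * x i) \<in> A} = unit_ball k"
  proof -
    have "L2_set (\<lambda>i. u i - (\<lambda>i\<in>{..<k}. u i + \<rho> * x i) i) {..<k} = \<rho> * L2_set x {..<k}" for x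
    proof -
      have "L2_set (\<lambda>i. u i - (\<lambda>i\<in>{..<k}. u i + \<rho> * x i) i) {..<k} = L2_set (\<lambda>i. \<rho> * x i) {..<k}"
        unfolding L2_set_def by (intro arg_cong[of _ _ sqrt] sum.cong) auto
      then show ?thesis using assms by (simp add: L2_set_right_distrib)
    qed
    then show ?thesis using assms by (auto simp: A_def unit_ball_def space_PiM)
  qed
  finally have vol: "emeasure ?L A = ennreal (\<rho> ^ k) * emeasure ?L (unit_ball k)" .
  have V: "emeasure ?L (unit_ball k) \<noteq> 0" "emeasure ?L (unit_ball k) \<noteq> \<top>"
    using unit_ball_vol_pos[of "real k", OF of_nat_0_le_iff]
    by (auto simp: emeasure_unit_ball ennreal_eq_0_iff not_le)
  have "emeasure (prior k) A = emeasure ?L (unit_ball k \<inter> A) / emeasure ?L (unit_ball k)"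
    by (simp add: prior_def emeasure_uniform_measure)
  also have "\<dots> \<le> emeasure ?L A / emeasure ?L (unit_ball k)"
    by (intro divide_right_mono_ennreal emeasure_mono) auto
  also have "\<dots> = ennreal (\<rho> ^ k)"
    using V by (simp add: vol ennreal_mult_divide_eq)
  finally show ?thesis by (simp add: A_def)
qed

text \<open>Stated for two measurable maps, so that one rule covers joint measurability and, with
  constant maps, both kinds of sections.\<close>

lemma measurable_pos_side [measurable]:
  assumes [measurable]: "U \<in> M \<rightarrow>\<^sub>M prior k" "f \<in> M \<rightarrow>\<^sub>M uniform_sphere (Suc k)"
  shows "Measurable.pred M (\<lambda>z. pos_side k (U z) (f z))"
proof -
  have "U \<in> M \<rightarrow>\<^sub>M Pi\<^sub>M {..<k} (\<lambda>_. borel)" "f \<in> M \<rightarrow>\<^sub>M Pi\<^sub>M {..<Suc k} (\<lambda>_. borel)"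
    using assms by (simp_all cong: measurable_cong_sets sets_PiM_cong)
  note comp = this[THEN measurable_compose, OF measurable_component_singleton]
  have [measurable]: "(\<lambda>z. U z i) \<in> borel_measurable M" if "i \<in> {..<k}" for i
    using comp(1) that by auto
  have [measurable]: "(\<lambda>z. f z i) \<in> borel_measurable M" if "i \<in> {..<Suc k}" for i
    using comp(2) that by auto
  have "(\<lambda>z. \<Sum>i<k. U z i * f z i) \<in> borel_measurable M"
    by (rule borel_measurable_sum) auto
  moreover have "(\<lambda>z. f z k) \<in> borel_measurable M" by measurable
  ultimately show ?thesis unfolding pos_side_def by measurable
qed

section \<open>The error in one round\<close>

text \<open>\<open>ennreal\<close> truncates negative terms to 0. Such terms can arise from cells
  whose prior probability is below \<open>\<rho> ^ k\<close>.\<close>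

lemma ennreal_sum_le: "ennreal (\<Sum>i\<in>A. f i) \<le> (\<Sum>i\<in>A. ennreal (f i))"
proof -
  have "ennreal (\<Sum>i\<in>A. f i) \<le> ennreal (\<Sum>i\<in>A. max 0 (f i))"
    by (intro ennreal_leI sum_mono) simp
  also have "\<dots> = (\<Sum>i\<in>A. ennreal (f i))"
    by (subst sum_ennreal[symmetric]) auto
  finally show ?thesis .
qed

text \<open>With \<open>P\<close> and \<open>Q\<close> the prior masses of the two parts of
  \<open>C\<close>, \<open>P * Q\<close> is at most \<open>min P Q\<close> times the mass of
  \<open>C\<close>. Integrated over \<open>x\<close>, \<open>P * Q\<close> becomes the probability
  that \<open>x\<close> separates \<open>u\<close> from \<open>v\<close>, integrated over
  \<open>u\<close> and \<open>v\<close> in \<open>C\<close>. For each \<open>u\<close> all of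
  \<open>C\<close> but a mass of \<open>\<rho> ^ k\<close> is farther than \<open>\<rho>\<close>
  away.\<close>

lemma cell_split:
  assumes C [measurable]: "C \<in> sets (prior k)" and "\<rho> > 0"
  shows "ennreal (sep_const * \<rho> * (measure (prior k) C - \<rho> ^ k)) \<le>
    (\<integral>\<^sup>+x. min (emeasure (prior k) {u \<in> C. pos_side k u x}) (emeasure (prior k) {u \<in> C. \<not> pos_side k u x})
      \<partial>uniform_sphere (Suc k))"
proof -
  let ?M = "prior k" and ?N = "uniform_sphere (Suc k)"
  interpret M: prob_space ?M by (rule prob_space_prior)
  interpret N: prob_space ?N by (rule prob_space_uniform_sphere)
  interpret MN: pair_sigma_finite ?M ?N by standard
  define p where "p u x = (if u \<in> C \<and> pos_side k u x then 1 else 0 :: ennreal)" for u x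
  define q where "q v x = (if v \<in> C \<and> \<not> pos_side k v x then 1 else 0 :: ennreal)" for v x
  have [measurable]: "(\<lambda>z. p (U z) (f z)) \<in> borel_measurable L" "(\<lambda>z. q (U z) (f z)) \<in> borel_measurable L"
    if [measurable]: "U \<in> L \<rightarrow>\<^sub>M ?M" "f \<in> L \<rightarrow>\<^sub>M ?N" for U f and L :: "'z measure"
    unfolding p_def q_def by measurable
  define P Q where "P x = emeasure ?M {u \<in> C. pos_side k u x}"
    and "Q x = emeasure ?M {u \<in> C. \<not> pos_side k u x}" for x
  have sub: "C \<subseteq> space ?M" using C by (rule sets.sets_into_space)
  have cells: "{u \<in> C. pos_side k u x} \<in> sets ?M" "{u \<in> C. \<not> pos_side k u x} \<in> sets ?M"
    if [measurable]: "x \<in> space ?N" for x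
  proof -
    have "{u \<in> C. pos_side k u x} = C \<inter> {u \<in> space ?M. pos_side k u x}"
      "{u \<in> C. \<not> pos_side k u x} = C \<inter> {u \<in> space ?M. \<not> pos_side k u x}"
      using sub by auto
    then show "{u \<in> C. pos_side k u x} \<in> sets ?M" "{u \<in> C. \<not> pos_side k u x} \<in> sets ?M"
      by (simp_all del: sets_prior space_prior) measurable
  qed
  have P: "P x = (\<integral>\<^sup>+u. p u x \<partial>?M)" and Q: "Q x = (\<integral>\<^sup>+u. q u x \<partial>?M)" if "x \<in> space ?N" for x
    unfolding P_def Q_def p_def q_def
    by (subst nn_integral_indicator[symmetric], rule cells[OF that],
        intro nn_integral_cong, simp add: indicator_def)+
  have le: "P x \<le> emeasure ?M C" "Q x \<le> emeasure ?M C" for x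
    unfolding P_def Q_def using C by (auto intro!: emeasure_mono)
  \<comment> \<open>Both sides are compared after multiplication by the mass of \<open>C\<close>,
    which is cancelled at the end.\<close>
  have "ennreal (sep_const * \<rho> * (measure ?M C - \<rho> ^ k)) * emeasure ?M C
      = (\<integral>\<^sup>+u. ennreal (sep_const * \<rho> * (measure ?M C - \<rho> ^ k)) * indicator C u \<partial>?M)"
    by (rule nn_integral_cmult_indicator[OF C, symmetric])
  also have "\<dots> \<le> (\<integral>\<^sup>+u. (\<integral>\<^sup>+v. (\<integral>\<^sup>+x. p u x * q v x \<partial>?N) \<partial>?M) \<partial>?M)"
  proof (rule nn_integral_mono_AE, use AE_prior[of k] AE_space in eventually_elim)
    case (elim u)
    show ?case
    proof (cases "u \<in> C")
      case True
      define B where "B = {v \<in> space ?M. L2_set (\<lambda>i. u i - v i) {..<k} \<le> \<rho>}"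
      have B [measurable]: "B \<in> sets ?M"
        unfolding B_def L2_set_def space_prior sets_prior by measurable
      have "measure ?M B \<le> \<rho> ^ k"
        using prior_small_ball[OF \<open>\<rho> > 0\<close>, of k u] \<open>\<rho> > 0\<close> by (simp add: B_def M.emeasure_eq_measure)
      moreover have "measure ?M C \<le> measure ?M (C - B) + measure ?M B"
        by (rule order.trans[OF M.finite_measure_mono measure_Un_le]) (use C B in auto)
      ultimately have "measure ?M C - \<rho> ^ k \<le> measure ?M (C - B)" by simp
      then have "ennreal (sep_const * \<rho> * (measure ?M C - \<rho> ^ k)) \<le> ennreal (sep_const * \<rho> * measure ?M (C - B))"
        using sep_const_pos \<open>\<rho> > 0\<close> by (intro ennreal_leI mult_left_mono) auto
      also have "\<dots> = (\<integral>\<^sup>+v. ennreal (sep_const * \<rho>) * indicator (C - B) v \<partial>?M)"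
        using sep_const_pos \<open>\<rho> > 0\<close> C B
        by (subst nn_integral_cmult_indicator) (auto simp: M.emeasure_eq_measure ennreal_mult)
      also have "\<dots> \<le> (\<integral>\<^sup>+v. (\<integral>\<^sup>+x. p u x * q v x \<partial>?N) \<partial>?M)"
      proof (rule nn_integral_mono_AE, use AE_prior[of k] AE_space in eventually_elim)
        case (elim v)
        show ?case
        proof (cases "v \<in> C - B")
          case v: True
          then have far: "\<rho> \<le> L2_set (\<lambda>i. u i - v i) {..<k}"
            using sub by (auto simp: B_def)
          have [measurable]: "u \<in> space ?M" "v \<in> space ?M" using True v sub by auto
          have "ennreal (sep_const * \<rho>) \<le> ennreal (sep_const * L2_set (\<lambda>i. u i - v i) {..<k})"
            using sep_const_pos far by (intro ennreal_leI mult_left_mono) auto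
          also have "\<dots> \<le> emeasure ?N {x \<in> space ?N. pos_side k u x \<and> \<not> pos_side k v x}"
            using elim \<open>L2_set u {..<k} \<le> 1\<close> by (intro sphere_separation) auto
          also have "\<dots> = (\<integral>\<^sup>+x. indicator {x \<in> space ?N. pos_side k u x \<and> \<not> pos_side k v x} x \<partial>?N)"
            by (rule nn_integral_indicator[symmetric]) measurable
          also have "\<dots> = (\<integral>\<^sup>+x. p u x * q v x \<partial>?N)"
            using True v by (intro nn_integral_cong) (auto simp: p_def q_def indicator_def)
          finally show ?thesis using v by simp
        qed simp
      qed
      finally show ?thesis using True by simp
    qed simp
  qed
  \<comment> \<open>Two exchanges move \<open>x\<close> outermost, where the integrand splits into a
    factor in \<open>u\<close> and a factor in \<open>v\<close>.\<close>
  also have "\<dots> = (\<integral>\<^sup>+u. (\<integral>\<^sup>+x. (\<integral>\<^sup>+v. p u x * q v x \<partial>?M) \<partial>?N) \<partial>?M)"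
    by (intro nn_integral_cong MN.Fubini'[symmetric]) measurable
  also have "\<dots> = (\<integral>\<^sup>+x. (\<integral>\<^sup>+u. (\<integral>\<^sup>+v. p u x * q v x \<partial>?M) \<partial>?M) \<partial>?N)"
    by (rule MN.Fubini'[symmetric]) measurable
  also have "\<dots> = (\<integral>\<^sup>+x. P x * Q x \<partial>?N)"
    by (intro nn_integral_cong) (simp add: P Q nn_integral_cmult nn_integral_multc)
  also have "\<dots> \<le> (\<integral>\<^sup>+x. min (P x) (Q x) * emeasure ?M C \<partial>?N)"
  proof (rule nn_integral_mono)
    fix x
    have "P x * Q x = min (P x) (Q x) * max (P x) (Q x)"
      by (auto simp: min_def max_def mult.commute)
    also have "\<dots> \<le> min (P x) (Q x) * emeasure ?M C"
      using le by (intro mult_left_mono) auto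
    finally show "P x * Q x \<le> min (P x) (Q x) * emeasure ?M C" .
  qed
  also have "\<dots> = (\<integral>\<^sup>+x. min (P x) (Q x) \<partial>?N) * emeasure ?M C"
  proof (rule nn_integral_multc)
    have "(\<lambda>x. min (\<integral>\<^sup>+u. p u x \<partial>?M) (\<integral>\<^sup>+u. q u x \<partial>?M)) \<in> borel_measurable ?N" by measurable
    then show "(\<lambda>x. min (P x) (Q x)) \<in> borel_measurable ?N"
      by (subst measurable_cong[where g = "\<lambda>x. min (\<integral>\<^sup>+u. p u x \<partial>?M) (\<integral>\<^sup>+u. q u x \<partial>?M)"]) (simp_all add: P Q)
  qed
  finally have *: "emeasure ?M C * ennreal (sep_const * \<rho> * (measure ?M C - \<rho> ^ k))
      \<le> emeasure ?M C * (\<integral>\<^sup>+x. min (P x) (Q x) \<partial>?N)" by (simp add: mult.commute)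
  \<comment> \<open>A null cell permits no cancellation, but its left-hand side is then 0.\<close>
  show ?thesis
  proof (cases "emeasure ?M C = 0")
    case True
    then have "sep_const * \<rho> * (measure ?M C - \<rho> ^ k) \<le> 0"
      using sep_const_pos \<open>\<rho> > 0\<close> by (simp add: measure_def mult_le_0_iff)
    then show ?thesis by (simp add: ennreal_neg)
  next
    case False
    then show ?thesis using * by (simp add: ennreal_mult_le_mult_iff P_def Q_def)
  qed
qed

lemma measurable_cell:
  assumes C [measurable]: "C \<in> sets (prior k)"
  shows "(\<lambda>x. emeasure (prior k) {u \<in> C. pos_side k u x}) \<in> borel_measurable (uniform_sphere (Suc k))"
    and "(\<lambda>x. emeasure (prior k) {u \<in> C. \<not> pos_side k u x}) \<in> borel_measurable (uniform_sphere (Suc k))"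
proof -
  let ?M = "prior k" and ?N = "uniform_sphere (Suc k)"
  interpret M: prob_space ?M by (rule prob_space_prior)
  have [measurable]: "Measurable.pred (?N \<Otimes>\<^sub>M ?M) (\<lambda>z. snd z \<in> C)"
    "Measurable.pred (?N \<Otimes>\<^sub>M ?M) (\<lambda>z. pos_side k (snd z) (fst z))"
    by measurable
  have sub: "C \<subseteq> space ?M" using C by (rule sets.sets_into_space)
  have "(\<lambda>x. emeasure ?M (Pair x -` {z \<in> space (?N \<Otimes>\<^sub>M ?M). snd z \<in> C \<and> pos_side k (snd z) (fst z)}))
      \<in> borel_measurable ?N"
    by (rule M.measurable_emeasure_Pair) measurable
  then show "(\<lambda>x. emeasure ?M {u \<in> C. pos_side k u x}) \<in> borel_measurable ?N"
    by (rule measurable_cong[THEN iffD1, rotated])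
      (use sub in \<open>auto simp: space_pair_measure intro!: arg_cong[of _ _ "emeasure ?M"]\<close>)
  have "(\<lambda>x. emeasure ?M (Pair x -` {z \<in> space (?N \<Otimes>\<^sub>M ?M). snd z \<in> C \<and> \<not> pos_side k (snd z) (fst z)}))
      \<in> borel_measurable ?N"
    by (rule M.measurable_emeasure_Pair) measurable
  then show "(\<lambda>x. emeasure ?M {u \<in> C. \<not> pos_side k u x}) \<in> borel_measurable ?N"
    by (rule measurable_cong[THEN iffD1, rotated])
      (use sub in \<open>auto simp: space_pair_measure intro!: arg_cong[of _ _ "emeasure ?M"]\<close>)
qed

text \<open>\<open>guess\<close> stands for the learner with all but the labels and the new point
  frozen, so it sees \<open>u\<close> only through its cell and errs on at least one of the two
  parts of that cell. Summing \<open>cell_split\<close> over the cells gives the bound, since there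
  are few of them.\<close>

lemma guess_error:
  fixes guess :: "nat set \<Rightarrow> (nat \<Rightarrow> real) \<Rightarrow> int"
  assumes k: "0 < k" and I: "finite I" and X: "\<And>i. i \<in> I \<Longrightarrow> X i \<in> space (uniform_sphere (Suc k))"
  shows "ennreal (sep_const / (4 * exp 1) * (real k / (real (card I) + real k))) \<le>
    (\<integral>\<^sup>+x. emeasure (prior k) {u \<in> space (prior k).
        guess {i \<in> I. pos_side k u (X i)} x \<noteq> (if pos_side k u x then 1 else - 1)} \<partial>uniform_sphere (Suc k))"
proof -
  let ?M = "prior k" and ?N = "uniform_sphere (Suc k)"
  interpret M: prob_space ?M by (rule prob_space_prior)
  define pat where "pat u = {i \<in> I. pos_side k u (X i)}" for u
  define \<P> where "\<P> = pat ` space ?M"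
  define cell where "cell T = {u \<in> space ?M. pat u = T}" for T
  define t where "t = card I"
  \<comment> \<open>Chosen so that the bound \<open>(exp 1 * (t + k) / k) ^ k\<close> on the number
    of cells, times \<open>\<rho> ^ k\<close>, is \<open>(1/2) ^ k\<close>; at least half of the
    prior mass then survives the subtraction of \<open>\<rho> ^ k\<close> in each cell.\<close>
  define \<rho> where "\<rho> = real k / (2 * exp 1 * real (t + k))"
  have \<rho>: "\<rho> > 0" using k by (simp add: \<rho>_def)
  have "\<P> \<subseteq> Pow I" by (auto simp: \<P>_def pat_def)
  then have fin: "finite \<P>" by (rule finite_subset) (simp add: I)
  have side [measurable]: "Measurable.pred ?M (\<lambda>u. pos_side k u (X i))" if "i \<in> I" for i
    using X[OF that] by (intro measurable_pos_side) auto
  have cell: "cell T \<in> sets ?M" if "T \<in> \<P>" for T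
  proof -
    have "T \<subseteq> I" using that \<open>\<P> \<subseteq> Pow I\<close> by auto
    then have "cell T = {u \<in> space ?M. \<forall>i\<in>I. pos_side k u (X i) \<longleftrightarrow> i \<in> T}"
      by (auto simp: cell_def pat_def)
    also have "\<dots> \<in> sets ?M"
      using I by (intro sets.sets_Collect_finite_All' sets.sets_Collect_finite_All) (auto simp del: sets_prior space_prior intro!: side[unfolded pred_def] sets.sets_Collect)
    finally show ?thesis .
  qed
  have half: "real (card \<P>) * \<rho> ^ k \<le> 1 / 2"
  proof -
    have "real (card \<P>) \<le> real (\<Sum>i\<le>k. t choose i)"
      unfolding \<P>_def pat_def t_def using card_patterns[OF I] by (intro of_nat_mono)
    also have "\<dots> \<le> (exp 1 * real (t + k) / real k) ^ k" by (rule sum_binomial_le[OF k])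
    finally have "real (card \<P>) * \<rho> ^ k \<le> (exp 1 * real (t + k) / real k) ^ k * \<rho> ^ k"
      using \<rho> by (intro mult_right_mono) auto
    also have "\<dots> = (1 / 2) ^ k"
      using k by (simp add: \<rho>_def flip: power_mult_distrib)
    also have "\<dots> \<le> (1 / 2) ^ 1" using k by (intro power_decreasing) auto
    finally show ?thesis by simp
  qed
  have "(\<Union>T\<in>\<P>. cell T) = space ?M" by (auto simp: cell_def \<P>_def)
  then have total: "(\<Sum>T\<in>\<P>. measure ?M (cell T)) = 1"
    using M.finite_measure_finite_Union[OF fin, of cell] cell M.prob_space
    by (auto simp: disjoint_family_on_def cell_def)
  let ?min = "\<lambda>T x. min (emeasure ?M {u \<in> cell T. pos_side k u x}) (emeasure ?M {u \<in> cell T. \<not> pos_side k u x})"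
  have "sep_const / (4 * exp 1) * (real k / (real (card I) + real k)) = sep_const * \<rho> * (1 / 2)"
    by (simp add: \<rho>_def t_def)
  also have "\<dots> \<le> sep_const * \<rho> * (1 - real (card \<P>) * \<rho> ^ k)"
    using half \<rho> sep_const_pos by (intro mult_left_mono) auto
  also have "\<dots> = (\<Sum>T\<in>\<P>. sep_const * \<rho> * (measure ?M (cell T) - \<rho> ^ k))"
    by (simp add: total sum_subtractf flip: sum_distrib_left)
  finally have "ennreal (sep_const / (4 * exp 1) * (real k / (real (card I) + real k)))
      \<le> ennreal (\<Sum>T\<in>\<P>. sep_const * \<rho> * (measure ?M (cell T) - \<rho> ^ k))" by (rule ennreal_leI)
  also have "\<dots> \<le> (\<Sum>T\<in>\<P>. ennreal (sep_const * \<rho> * (measure ?M (cell T) - \<rho> ^ k)))"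
    by (rule ennreal_sum_le)
  also have "\<dots> \<le> (\<Sum>T\<in>\<P>. \<integral>\<^sup>+x. ?min T x \<partial>?N)"
    by (intro sum_mono cell_split cell \<rho>)
  also have "\<dots> = (\<integral>\<^sup>+x. (\<Sum>T\<in>\<P>. ?min T x) \<partial>?N)"
    using cell measurable_cell by (intro nn_integral_sum[symmetric] borel_measurable_min) auto
  also have "\<dots> \<le> (\<integral>\<^sup>+x. emeasure ?M {u \<in> space ?M. guess (pat u) x \<noteq> (if pos_side k u x then 1 else - 1)} \<partial>?N)"
  proof (rule nn_integral_mono)
    fix x assume x: "x \<in> space ?N"
    have pos [measurable]: "Measurable.pred ?M (\<lambda>u. pos_side k u x)"
      using x by (intro measurable_pos_side) auto
    \<comment> \<open>A part of the cell on which the guess is certainly wrong. Any guess other than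
      1 is wrong on the positive side, whatever integer it is.\<close>
    define W where "W T = {u \<in> cell T. if guess T x = 1 then \<not> pos_side k u x else pos_side k u x}" for T
    have W: "W T \<in> sets ?M" if "T \<in> \<P>" for T
    proof -
      have "W T = cell T \<inter> {u \<in> space ?M. if guess T x = 1 then \<not> pos_side k u x else pos_side k u x}"
        by (auto simp: W_def cell_def)
      also have "\<dots> \<in> sets ?M"
        by (rule sets.Int[OF cell[OF that]]) measurable
      finally show ?thesis .
    qed
    have V: "{u \<in> cell T. guess T x \<noteq> (if pos_side k u x then 1 else - 1)} \<in> sets ?M" if "T \<in> \<P>" for T
    proof -
      have "{u \<in> cell T. guess T x \<noteq> (if pos_side k u x then 1 else - 1)}
          = cell T \<inter> {u \<in> space ?M. if pos_side k u x then guess T x \<noteq> 1 else guess T x \<noteq> - 1}"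
        by (auto simp: cell_def)
      also have "\<dots> \<in> sets ?M"
        by (rule sets.Int[OF cell[OF that]]) measurable
      finally show ?thesis .
    qed
    have "(\<Sum>T\<in>\<P>. ?min T x) \<le> (\<Sum>T\<in>\<P>. emeasure ?M (W T))"
    proof (rule sum_mono)
      fix T
      show "?min T x \<le> emeasure ?M (W T)" by (cases "guess T x = 1") (simp_all add: W_def)
    qed
    also have "\<dots> = emeasure ?M (\<Union>T\<in>\<P>. W T)"
    proof (rule sum_emeasure)
      show "W ` \<P> \<subseteq> sets ?M" using W by blast
      show "disjoint_family_on W \<P>" by (auto simp: disjoint_family_on_def W_def cell_def)
    qed (rule fin)
    also have "\<dots> \<le> emeasure ?M (\<Union>T\<in>\<P>. {u \<in> cell T. guess T x \<noteq> (if pos_side k u x then 1 else - 1)})"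
      using V fin by (intro emeasure_mono sets.finite_UN) (auto simp: W_def split: if_splits)
    also have "(\<Union>T\<in>\<P>. {u \<in> cell T. guess T x \<noteq> (if pos_side k u x then 1 else - 1)})
        = {u \<in> space ?M. guess (pat u) x \<noteq> (if pos_side k u x then 1 else - 1)}"
      by (auto simp: cell_def \<P>_def)
    finally show "(\<Sum>T\<in>\<P>. ?min T x)
      \<le> emeasure ?M {u \<in> space ?M. guess (pat u) x \<noteq> (if pos_side k u x then 1 else - 1)}" .
  qed
  finally show ?thesis by (simp only: pat_def)
qed

section \<open>Expected number of mistakes\<close>

text \<open>Both conventions count the boundary value 0 as positive, so no exceptional points
  arise.\<close>

lemma halfspace_label_lift: "halfspace_label (Suc k) (u(k := 1)) x = (if pos_side k u x then 1 else - 1)"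
proof -
  have "(\<Sum>i<Suc k. (u(k := 1)) i * x i) = x k + (\<Sum>i<k. u i * x i)"
    by (simp add: add.commute)
  then show ?thesis by (simp only: halfspace_label_def pos_side_def)
qed

lemma measurable_sample_label:
  assumes U: "U \<in> L \<rightarrow>\<^sub>M prior k" and Y: "Y \<in> L \<rightarrow>\<^sub>M iid_sphere_samples (Suc k) n"
  shows "(\<lambda>z. halfspace_label (Suc k) ((U z)(k := 1)) (Y z i)) \<in> L \<rightarrow>\<^sub>M count_space UNIV"
proof -
  have "Measurable.pred L (\<lambda>z. pos_side k (U z) (Y z i))"
  proof (cases "i < n")
    case True
    then have "(\<lambda>z. Y z i) \<in> L \<rightarrow>\<^sub>M uniform_sphere (Suc k)"
      using Y unfolding iid_sphere_samples_def
      by (intro measurable_compose[OF Y[unfolded iid_sphere_samples_def] measurable_component_singleton]) simp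
    with U show ?thesis by (rule measurable_pos_side)
  next
    \<comment> \<open>Outside the index range the sample is the constant \<open>undefined\<close>.
      This case is covered so that histories may be arbitrary lists of indices.\<close>
    case False
    have [measurable]: "(\<lambda>z. U z j) \<in> borel_measurable L" if "j \<in> {..<k}" for j
      using that U by (intro measurable_compose[OF _ measurable_component_singleton[of j "{..<k}" "\<lambda>_. borel"]])
        (simp_all cong: measurable_cong_sets sets_PiM_cong)
    have "Measurable.pred L (\<lambda>z. pos_side k (U z) undefined)"
      unfolding pos_side_def by measurable
    moreover have "Y z i = undefined" if "z \<in> space L" for z
      using measurable_space[OF Y that] False by (auto simp: iid_sphere_samples_def space_PiM PiE_iff extensional_def)
    ultimately show ?thesis by (simp cong: measurable_cong)
  qed
  then show ?thesis unfolding halfspace_label_lift by measurable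
qed

text \<open>Labelled histories form a countable type, so measurability can be checked by adding one
  entry at a time. It allows the learner to be evaluated at a random history.\<close>

lemma measurable_map_pair:
  fixes g :: "'z \<Rightarrow> 'i :: countable \<Rightarrow> 'b :: countable"
  assumes g [measurable]: "\<And>i. (\<lambda>z. g z i) \<in> L \<rightarrow>\<^sub>M count_space UNIV"
  shows "(\<lambda>z. map (\<lambda>i. (i, g z i)) is) \<in> L \<rightarrow>\<^sub>M count_space UNIV"
proof (induction "is")
  case (Cons j js)
  note [measurable] = Cons.IH
  have "(\<lambda>z. (j, g z j) # map (\<lambda>i. (i, g z i)) js) \<in> L \<rightarrow>\<^sub>M count_space UNIV"
    by (rule measurable_compose_countable[OF _ Cons.IH]) measurable
  then show ?case by simp
qed simp

text \<open>The error event of a single round, with the earlier indices \<open>is\<close> and the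
  queried index \<open>j\<close> frozen. For a fixed order of presentation only the seed, the normal
  vector and the samples remain random.\<close>

definition errs :: "nat \<Rightarrow> learner \<Rightarrow> real \<Rightarrow> nat list \<Rightarrow> nat \<Rightarrow> (nat \<Rightarrow> real) \<Rightarrow> (nat \<Rightarrow> nat \<Rightarrow> real) \<Rightarrow> bool" where
  "errs k A s is j u X \<longleftrightarrow>
    A s X (map (\<lambda>i. (i, halfspace_label (Suc k) (u(k := 1)) (X i))) is) j \<noteq> halfspace_label (Suc k) (u(k := 1)) (X j)"

lemma measurable_errs:
  assumes A: "online_learner (Suc k) n R A"
    and U: "U \<in> L \<rightarrow>\<^sub>M prior k" and S: "S \<in> L \<rightarrow>\<^sub>M R" and Y: "Y \<in> L \<rightarrow>\<^sub>M iid_sphere_samples (Suc k) n"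
  shows "Measurable.pred L (\<lambda>z. errs k A (S z) is j (U z) (Y z))"
proof -
  note [measurable] = measurable_sample_label[OF U Y] S Y
  have "(\<lambda>(s, X). A s X h i) \<in> R \<Otimes>\<^sub>M iid_sphere_samples (Suc k) n \<rightarrow>\<^sub>M count_space UNIV" for h i
    using A unfolding online_learner_def
    by (auto intro: measurable_compose[where N = "count_space {- 1, 1}"])
  from measurable_compose[OF measurable_Pair[OF S Y] this]
  have "(\<lambda>z. A (S z) (Y z) h i) \<in> L \<rightarrow>\<^sub>M count_space UNIV" for h i by simp
  from measurable_compose_countable[OF this measurable_map_pair[OF measurable_sample_label[OF U Y]]]
  have [measurable]: "(\<lambda>z. A (S z) (Y z) (map (\<lambda>i. (i, halfspace_label (Suc k) ((U z)(k := 1)) (Y z i))) is) j)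
      \<in> L \<rightarrow>\<^sub>M count_space UNIV" .
  show ?thesis unfolding errs_def by measurable
qed

text \<open>The queried point is independent of the remaining samples. With these held fixed, the
  learner is a \<open>guess\<close> depending on the earlier labels and the new point
  \<open>x\<close>, even though it sees the whole sample \<open>X(j := x)\<close>. The resulting
  bound is uniform in the other samples and is then integrated over them.\<close>

lemma round_error:
  assumes A: "online_learner (Suc k) n R A" and k: "0 < k" and s: "s \<in> space R"
    and "is": "distinct is" "set is \<subseteq> {..<n}" "j < n" "j \<notin> set is"
  shows "ennreal (sep_const / (4 * exp 1) * (real k / (real (length is) + real k))) \<le>
    (\<integral>\<^sup>+X. emeasure (prior k) {u \<in> space (prior k). errs k A s is j u X} \<partial>iid_sphere_samples (Suc k) n)"
    (is "?c \<le> _")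
proof -
  let ?M = "prior k" and ?N = "uniform_sphere (Suc k)" and ?S = "iid_sphere_samples (Suc k) n"
  interpret M: prob_space ?M by (rule prob_space_prior)
  interpret N: product_sigma_finite "\<lambda>_ :: nat. ?N"
    by (simp add: product_sigma_finite_def prob_space_imp_sigma_finite prob_space_uniform_sphere)
  define J where "J = {..<n} - {j}"
  have J: "finite J" "j \<notin> J" "insert j J = {..<n}" using \<open>j < n\<close> by (auto simp: J_def)
  interpret PJ: prob_space "Pi\<^sub>M J (\<lambda>_. ?N)" by (intro prob_space_PiM prob_space_uniform_sphere)
  let ?g = "\<lambda>X. emeasure ?M {u \<in> space ?M. errs k A s is j u X}"
  have "Measurable.pred (?S \<Otimes>\<^sub>M ?M) (\<lambda>z. errs k A s is j (snd z) (fst z))"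
    using s by (intro measurable_errs[OF A]) auto
  then have "(\<lambda>X. emeasure ?M (Pair X -` {z \<in> space (?S \<Otimes>\<^sub>M ?M). errs k A s is j (snd z) (fst z)})) \<in> borel_measurable ?S"
    by (intro M.measurable_emeasure_Pair) (simp only: pred_def)
  then have g: "?g \<in> borel_measurable ?S"
    by (rule measurable_cong[THEN iffD1, rotated])
      (auto simp: space_pair_measure intro!: arg_cong[of _ _ "emeasure ?M"])
  have "?c = (\<integral>\<^sup>+X. ?c \<partial>Pi\<^sub>M J (\<lambda>_. ?N))" by (simp add: PJ.emeasure_space_1)
  also have "\<dots> \<le> (\<integral>\<^sup>+X. (\<integral>\<^sup>+x. ?g (X(j := x)) \<partial>?N) \<partial>Pi\<^sub>M J (\<lambda>_. ?N))"
  proof (rule nn_integral_mono)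
    fix X assume X: "X \<in> space (Pi\<^sub>M J (\<lambda>_. ?N))"
    \<comment> \<open>The history is rebuilt from the set \<open>T\<close> of positively labelled
      indices, which displays the dependence on \<open>u\<close> through the pattern alone.\<close>
    let ?guess = "\<lambda>T x. A s (X(j := x)) (map (\<lambda>i. (i, if i \<in> T then 1 else - 1)) is) j"
    have eq: "?guess {i \<in> set is. pos_side k u (X i)} x \<noteq> (if pos_side k u x then 1 else - 1)
        \<longleftrightarrow> errs k A s is j u (X(j := x))" for u x
    proof -
      have "map (\<lambda>i. (i, if i \<in> {i \<in> set is. pos_side k u (X i)} then 1 else - 1 :: int)) is
        = map (\<lambda>i. (i, halfspace_label (Suc k) (u(k := 1)) ((X(j := x)) i))) is"
        using "is" by (intro map_cong) (auto simp: halfspace_label_lift)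
      then show ?thesis by (simp only: errs_def halfspace_label_lift fun_upd_same)
    qed
    have "?c = ennreal (sep_const / (4 * exp 1) * (real k / (real (card (set is)) + real k)))"
      using "is" by (simp add: distinct_card)
    also have "\<dots> \<le> (\<integral>\<^sup>+x. emeasure ?M {u \<in> space ?M.
        ?guess {i \<in> set is. pos_side k u (X i)} x \<noteq> (if pos_side k u x then 1 else - 1)} \<partial>?N)"
      using X "is" by (intro guess_error[OF k]) (auto simp: space_PiM J_def PiE_iff)
    also have "\<dots> = (\<integral>\<^sup>+x. ?g (X(j := x)) \<partial>?N)" by (simp only: eq)
    finally show "?c \<le> (\<integral>\<^sup>+x. ?g (X(j := x)) \<partial>?N)" .
  qed
  also have "\<dots> = integral\<^sup>N ?S ?g"
    using N.product_nn_integral_insert[OF J(1,2), of ?g] g by (simp add: J(3) iid_sphere_samples_def)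
  finally show ?thesis .
qed

text \<open>The number of mistakes is a sum of round errors. The bounds for single rounds hold for
  every seed and every order, so they may be summed and integrated; Fubini's theorem then brings the
  prior to the outside.\<close>

lemma expected_mistakes_prior:
  assumes A: "online_learner (Suc k) n R A" and k: "0 < k" and m: "m \<le> n"
  shows "ennreal (\<Sum>t<m. sep_const / (4 * exp 1) * (real k / (real t + real k))) \<le>
    (\<integral>\<^sup>+u. ennreal (expected_mistakes (Suc k) n m R A (u(k := 1))) \<partial>prior k)"
    (is "?c \<le> _")
proof -
  let ?M = "prior k" and ?N = "uniform_sphere (Suc k)" and ?S = "iid_sphere_samples (Suc k) n"
  let ?P = "measure_pmf (pmf_of_set (permutations_of_set {..<n}))"
  let ?Z = "R \<Otimes>\<^sub>M (?S \<Otimes>\<^sub>M ?P)"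
  interpret M: prob_space ?M by (rule prob_space_prior)
  interpret R: prob_space R using A by (simp add: online_learner_def)
  interpret S: prob_space ?S
    unfolding iid_sphere_samples_def by (intro prob_space_PiM prob_space_uniform_sphere)
  interpret P: prob_space ?P by (rule prob_space_measure_pmf)
  interpret SP: pair_prob_space ?S ?P ..
  interpret Z: pair_prob_space R "?S \<Otimes>\<^sub>M ?P" ..
  interpret MZ: pair_sigma_finite ?M ?Z ..
  define F where "F u s X p = (\<Sum>t<m. indicator {u. errs k A s (take t p) (p ! t) u X} u :: ennreal)" for u s X p
  have mist: "ennreal (real (mistakes (Suc k) m A (u(k := 1)) s X p)) = F u s X p" for u s X p
  proof -
    have "real (mistakes (Suc k) m A (u(k := 1)) s X p) = (\<Sum>t<m. indicator {u. errs k A s (take t p) (p ! t) u X} u)"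
      by (simp add: mistakes_def errs_def indicator_def of_bool_def sum.If_cases Int_def)
    then show ?thesis
      unfolding F_def by (simp only: sum_ennreal[symmetric] indicator_pos_le ennreal_indicator)
  qed
  have F: "(\<lambda>z. F (U z) (S z) (Y z) (Q z)) \<in> borel_measurable L"
    if U: "U \<in> L \<rightarrow>\<^sub>M ?M" and S: "S \<in> L \<rightarrow>\<^sub>M R" and Y: "Y \<in> L \<rightarrow>\<^sub>M ?S" and Q: "Q \<in> L \<rightarrow>\<^sub>M count_space UNIV"
    for U S Y Q and L :: "'z measure"
  proof (rule measurable_compose_countable[OF _ Q])
    fix p :: "nat list"
    note [measurable] = measurable_errs[OF A U S Y]
    show "(\<lambda>z. F (U z) (S z) (Y z) p) \<in> borel_measurable L"
      unfolding F_def indicator_def mem_Collect_eq of_bool_def by measurable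
  qed
  have em: "ennreal (expected_mistakes (Suc k) n m R A (u(k := 1))) = (\<integral>\<^sup>+(s, X, p). F u s X p \<partial>?Z)" for u
  proof -
    \<comment> \<open>\<open>expected_mistakes\<close> is a Bochner integral, with default value 0
      for a non-integrable function. The bound by \<open>m\<close> provides integrability, so it
      agrees with the nonnegative integral.\<close>
    have "integrable ?Z (\<lambda>(s, X, p). real (mistakes (Suc k) m A (u(k := 1)) s X p))"
    proof (rule Z.integrable_const_bound[where B = "real m"])
      have "mistakes (Suc k) m A (u(k := 1)) s X p \<le> m" for s X p
        unfolding mistakes_def by (rule order.trans[OF card_mono[of "{..<m}"]]) auto
      then show "AE z in ?Z. norm (case z of (s, X, p) \<Rightarrow> real (mistakes (Suc k) m A (u(k := 1)) s X p)) \<le> real m"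
        by (auto simp: case_prod_unfold)
    qed (rule measurable_mistakes[OF A])
    then have "ennreal (expected_mistakes (Suc k) n m R A (u(k := 1)))
        = (\<integral>\<^sup>+z. ennreal (case z of (s, X, p) \<Rightarrow> real (mistakes (Suc k) m A (u(k := 1)) s X p)) \<partial>?Z)"
      unfolding expected_mistakes_def by (subst nn_integral_eq_integral) (auto simp: case_prod_unfold)
    then show ?thesis by (simp add: case_prod_unfold mist)
  qed
  have bound: "?c \<le> (\<integral>\<^sup>+X. (\<integral>\<^sup>+u. F u s X p \<partial>?M) \<partial>?S)"
    if s: "s \<in> space R" and p: "p \<in> permutations_of_set {..<n}" for s p
  proof -
    have p': "distinct p" "set p = {..<n}" "length p = n"
      using p by (auto simp: permutations_of_set_def length_finite_permutations_of_set dest: distinct_card)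
    let ?E = "\<lambda>t X. emeasure ?M {u \<in> space ?M. errs k A s (take t p) (p ! t) u X}"
    have "?c \<le> (\<Sum>t<m. ennreal (sep_const / (4 * exp 1) * (real k / (real t + real k))))"
      by (rule ennreal_sum_le)
    also have "\<dots> \<le> (\<Sum>t<m. \<integral>\<^sup>+X. ?E t X \<partial>?S)"
    proof (rule sum_mono)
      fix t assume "t \<in> {..<m}"
      then have t: "t < length p" using m p' by simp
      have "p ! t \<notin> set (take t p)"
        using p'(1) t by (auto simp: in_set_conv_nth nth_eq_iff_index_eq)
      moreover have "p ! t < n" using t p' nth_mem by blast
      moreover have "set (take t p) \<subseteq> {..<n}" using p'(2) set_take_subset by fastforce
      ultimately show "ennreal (sep_const / (4 * exp 1) * (real k / (real t + real k))) \<le> (\<integral>\<^sup>+X. ?E t X \<partial>?S)"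
        using round_error[OF A k s, of "take t p" "p ! t"] p'(1) t by simp
    qed
    also have "\<dots> = (\<integral>\<^sup>+X. (\<Sum>t<m. ?E t X) \<partial>?S)"
    proof (rule nn_integral_sum[symmetric])
      fix t
      have "Measurable.pred (?S \<Otimes>\<^sub>M ?M) (\<lambda>z. errs k A s (take t p) (p ! t) (snd z) (fst z))"
        using s by (intro measurable_errs[OF A]) auto
      then have "(\<lambda>X. emeasure ?M (Pair X -` {z \<in> space (?S \<Otimes>\<^sub>M ?M). errs k A s (take t p) (p ! t) (snd z) (fst z)})) \<in> borel_measurable ?S"
        by (intro M.measurable_emeasure_Pair) (simp only: pred_def)
      then show "?E t \<in> borel_measurable ?S"
        by (rule measurable_cong[THEN iffD1, rotated])
          (auto simp: space_pair_measure intro!: arg_cong[of _ _ "emeasure ?M"])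
    qed
    also have "\<dots> = (\<integral>\<^sup>+X. (\<integral>\<^sup>+u. F u s X p \<partial>?M) \<partial>?S)"
    proof (rule nn_integral_cong)
      fix X assume X: "X \<in> space ?S"
      have "Measurable.pred ?M (\<lambda>u. errs k A s (take t p) (p ! t) u X)" for t
        using s X by (intro measurable_errs[OF A]) auto
      then have sets: "{u \<in> space ?M. errs k A s (take t p) (p ! t) u X} \<in> sets ?M" for t
        by (simp only: pred_def)
      have "(\<integral>\<^sup>+u. F u s X p \<partial>?M)
          = (\<integral>\<^sup>+u. (\<Sum>t<m. indicator {u \<in> space ?M. errs k A s (take t p) (p ! t) u X} u) \<partial>?M)"
        unfolding F_def by (intro nn_integral_cong sum.cong) (auto simp: indicator_def)
      also have "\<dots> = (\<Sum>t<m. ?E t X)"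
        using sets by (subst nn_integral_sum) auto
      finally show "(\<Sum>t<m. ?E t X) = (\<integral>\<^sup>+u. F u s X p \<partial>?M)" ..
    qed
    finally show ?thesis .
  qed
  have "?c = (\<integral>\<^sup>+s. (\<integral>\<^sup>+p. ?c \<partial>?P) \<partial>R)"
    by (simp add: R.emeasure_space_1)
  also have "\<dots> \<le> (\<integral>\<^sup>+s. (\<integral>\<^sup>+p. (\<integral>\<^sup>+X. (\<integral>\<^sup>+u. F u s X p \<partial>?M) \<partial>?S) \<partial>?P) \<partial>R)"
  proof (rule nn_integral_mono)
    fix s assume "s \<in> space R"
    then have "AE p in ?P. ?c \<le> (\<integral>\<^sup>+X. (\<integral>\<^sup>+u. F u s X p \<partial>?M) \<partial>?S)"
      using bound by (simp add: AE_measure_pmf_iff)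
    then show "(\<integral>\<^sup>+p. ?c \<partial>?P) \<le> (\<integral>\<^sup>+p. (\<integral>\<^sup>+X. (\<integral>\<^sup>+u. F u s X p \<partial>?M) \<partial>?S) \<partial>?P)"
      by (rule nn_integral_mono_AE)
  qed
  \<comment> \<open>First \<open>p\<close> and \<open>X\<close> are exchanged to match the nesting
    of \<open>?Z\<close>, then the three outer integrals are merged, and last the prior is moved
    outside.\<close>
  also have "\<dots> = (\<integral>\<^sup>+s. (\<integral>\<^sup>+X. (\<integral>\<^sup>+p. (\<integral>\<^sup>+u. F u s X p \<partial>?M) \<partial>?P) \<partial>?S) \<partial>R)"
  proof (rule nn_integral_cong, rule SP.Fubini')
    fix s assume s: "s \<in> space R"
    have "(\<lambda>z. F (snd z) s (fst (fst z)) (snd (fst z))) \<in> borel_measurable ((?S \<Otimes>\<^sub>M ?P) \<Otimes>\<^sub>M ?M)"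
      using s by (intro F) auto
    then have "(\<lambda>(z, u). F u s (fst z) (snd z)) \<in> borel_measurable ((?S \<Otimes>\<^sub>M ?P) \<Otimes>\<^sub>M ?M)"
      by (simp add: case_prod_unfold)
    from M.borel_measurable_nn_integral[OF this]
    show "(\<lambda>(X, p). \<integral>\<^sup>+u. F u s X p \<partial>?M) \<in> borel_measurable (?S \<Otimes>\<^sub>M ?P)" by (simp add: case_prod_unfold)
  qed
  also have "\<dots> = (\<integral>\<^sup>+(s, X, p). (\<integral>\<^sup>+u. F u s X p \<partial>?M) \<partial>?Z)"
  proof -
    have "(\<lambda>z. F (snd z) (fst (fst z)) (fst (snd (fst z))) (snd (snd (fst z)))) \<in> borel_measurable (?Z \<Otimes>\<^sub>M ?M)"
      by (intro F) auto
    then have "(\<lambda>(z, u). F u (fst z) (fst (snd z)) (snd (snd z))) \<in> borel_measurable (?Z \<Otimes>\<^sub>M ?M)"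
      by (simp add: case_prod_unfold)
    from M.borel_measurable_nn_integral[OF this]
    have G: "(\<lambda>(s, X, p). \<integral>\<^sup>+u. F u s X p \<partial>?M) \<in> borel_measurable ?Z" by (simp add: case_prod_unfold)
    have "(\<integral>\<^sup>+X. (\<integral>\<^sup>+p. (\<integral>\<^sup>+u. F u s X p \<partial>?M) \<partial>?P) \<partial>?S)
        = (\<integral>\<^sup>+(X, p). (\<integral>\<^sup>+u. F u s X p \<partial>?M) \<partial>(?S \<Otimes>\<^sub>M ?P))" if "s \<in> space R" for s
      using sigma_finite_measure.nn_integral_fst[OF prob_space_imp_sigma_finite[OF prob_space_measure_pmf], of "\<lambda>(X, p). \<integral>\<^sup>+u. F u s X p \<partial>?M" ?S] measurable_Pair2[OF G that]
      by (simp add: case_prod_unfold)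
    then have "(\<integral>\<^sup>+s. (\<integral>\<^sup>+X. (\<integral>\<^sup>+p. (\<integral>\<^sup>+u. F u s X p \<partial>?M) \<partial>?P) \<partial>?S) \<partial>R)
        = (\<integral>\<^sup>+s. (\<integral>\<^sup>+(X, p). (\<integral>\<^sup>+u. F u s X p \<partial>?M) \<partial>(?S \<Otimes>\<^sub>M ?P)) \<partial>R)"
      by (intro nn_integral_cong)
    also have "\<dots> = (\<integral>\<^sup>+(s, X, p). (\<integral>\<^sup>+u. F u s X p \<partial>?M) \<partial>?Z)"
      using sigma_finite_measure.nn_integral_fst[OF prob_space_imp_sigma_finite[OF SP.prob_space_axioms] G] by (simp add: case_prod_unfold)
    finally show ?thesis .
  qed
  also have "\<dots> = (\<integral>\<^sup>+u. (\<integral>\<^sup>+(s, X, p). F u s X p \<partial>?Z) \<partial>?M)"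
  proof -
    have "(\<lambda>z. F (fst z) (fst (snd z)) (fst (snd (snd z))) (snd (snd (snd z)))) \<in> borel_measurable (?M \<Otimes>\<^sub>M ?Z)"
      by (intro F) auto
    then have "(\<lambda>(u, z). F u (fst z) (fst (snd z)) (snd (snd z))) \<in> borel_measurable (?M \<Otimes>\<^sub>M ?Z)"
      by (simp add: case_prod_unfold)
    from MZ.Fubini'[OF this] show ?thesis by (simp add: case_prod_unfold)
  qed
  also have "\<dots> = (\<integral>\<^sup>+u. ennreal (expected_mistakes (Suc k) n m R A (u(k := 1))) \<partial>?M)"
    by (simp add: em)
  finally show ?thesis .
qed

section \<open>The harmonic sum and the conclusion\<close>

lemma ln_le_sum_inverse:
  assumes "0 < k"
  shows "ln (1 + real m / real k) \<le> (\<Sum>t<m. 1 / (real t + real k))"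
proof (induction m)
  case (Suc m)
  have pos: "0 < real m + real k" using assms by simp
  \<comment> \<open>The factors \<open>1 + 1 / (t + k)\<close> telescope to
    \<open>1 + m / k\<close>, and \<open>ln (1 + x) \<le> x\<close> bounds the logarithm of
    each.\<close>
  have "1 + real (Suc m) / real k = (1 + real m / real k) * (1 + 1 / (real m + real k))"
  proof -
    have "1 + real m / real k = (real m + real k) / real k"
      "1 + 1 / (real m + real k) = (real m + real k + 1) / (real m + real k)"
      "1 + real (Suc m) / real k = (real m + real k + 1) / real k"
      using assms pos by (simp_all add: add_divide_distrib)
    then show ?thesis using pos by simp
  qed
  then have "ln (1 + real (Suc m) / real k) = ln (1 + real m / real k) + ln (1 + 1 / (real m + real k))"
  proof (simp only:, intro ln_mult_pos)
    show "0 < 1 + real m / real k" by (intro add_pos_nonneg) auto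
    show "0 < 1 + 1 / (real m + real k)" by (intro add_pos_nonneg) auto
  qed
  also have "ln (1 + 1 / (real m + real k)) \<le> 1 / (real m + real k)"
    using pos by (intro ln_add_one_self_le_self) simp
  finally show ?case using Suc by simp
qed simp

text \<open>Bernoulli's inequality for the hundredth power. The 100 reflects that only one percent
  of the samples need be labelled; it costs a constant factor in the logarithm.\<close>

lemma ln_add_one_divide_ge:
  fixes z :: real
  assumes "0 < z"
  shows "ln z / 100 \<le> ln (1 + z / 100)"
proof -
  have "z \<le> 1 + real 100 * (z / 100)" by simp
  also have "\<dots> \<le> (1 + z / 100) ^ 100" using assms by (intro Bernoulli_inequality) simp
  finally have "ln z \<le> ln ((1 + z / 100) ^ 100)" using assms by simp
  then show ?thesis using assms by (simp add: ln_realpow)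
qed

text \<open>Labels depend only on the direction of the normal vector, so the lifted vector
  \<open>(u, 1)\<close> may be rescaled to unit norm.\<close>

lemma expected_mistakes_divide:
  assumes "0 < r"
  shows "expected_mistakes d n m R A (\<lambda>i. w i / r) = expected_mistakes d n m R A w"
proof -
  have "halfspace_label d (\<lambda>i. w i / r) = halfspace_label d w"
    using assms by (simp add: halfspace_label_def fun_eq_iff zero_le_divide_iff flip: sum_divide_distrib)
  then show ?thesis by (simp add: expected_mistakes_def mistakes_def)
qed

text \<open>The averaged bound has order \<open>d * ln (1 + m / k)\<close> with
  \<open>k = d - 1\<close>. The condition \<open>n \<ge> d powr (1 + \<epsilon>)\<close> makes this
  a constant fraction of \<open>d * ln n\<close>; for \<open>n\<close> of order \<open>d\<close> the
  \<open>n\<close> rounds could not contain that many mistakes. In dimension 1 a single label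
  determines the halfspace, hence \<open>d \<ge> 2\<close>. A bad normal vector for a given learner
  exists because the prior average is large.\<close>

theorem proposition17:
  shows "\<forall>\<epsilon>::real. \<epsilon> > 0 \<longrightarrow> (\<exists>c::real. c > 0 \<and>
    (\<forall>(d::nat) (n::nat) (m::nat).
       d \<ge> 2 \<and> real n \<ge> real d powr (1 + \<epsilon>) \<and> real n / 100 \<le> real m \<and> m \<le> n \<longrightarrow>
       (\<forall>(R::real measure) (A::learner). online_learner d n R A \<longrightarrow>
          (\<exists>w. L2_set w {..<d} = 1 \<and>
               expected_mistakes d n m R A w \<ge> c * real d * ln (real n)))))"
proof (intro allI impI)
  fix \<epsilon> :: real assume \<epsilon>: "\<epsilon> > 0"
  define c1 where "c1 = sep_const / (4 * exp 1)"
  \<comment> \<open>From \<open>(1 + \<epsilon>) * ln d \<le> ln n\<close> it follows that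
    \<open>ln (n / d)\<close> is at least \<open>q * ln n\<close>.\<close>
  define q where "q = \<epsilon> / (1 + \<epsilon>)"
  have q: "q > 0" using \<epsilon> by (simp add: q_def)
  \<comment> \<open>400 is the product of 100 for the one percent, 2 for
    \<open>d \<le> 2 * k\<close>, and 2 for the slack in the averaging argument.\<close>
  define c where "c = c1 * q / 400"
  have c1: "c1 > 0" using sep_const_pos by (simp add: c1_def)
  then have c: "c > 0" using q by (simp add: c_def)
  have "\<exists>w. L2_set w {..<d} = 1 \<and> expected_mistakes d n m R A w \<ge> c * real d * ln (real n)"
    if d: "d \<ge> 2" and n: "real n \<ge> real d powr (1 + \<epsilon>)" and m: "real n / 100 \<le> real m" "m \<le> n"
      and A: "online_learner d n R A" for d n m R A
  proof -
    obtain k where k: "d = Suc k" "0 < k" using d by (cases d) auto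
    define K where "K = c * real d * ln (real n)"
    have "1 < real d powr (1 + \<epsilon>)" using d \<epsilon> by simp
    then have n1: "1 < real n" using n by linarith
    then have K: "K > 0" using c d by (simp add: K_def)
    have "ln (real d powr (1 + \<epsilon>)) \<le> ln (real n)" using n d n1 by (intro ln_mono) auto
    then have lnd: "(1 + \<epsilon>) * ln (real d) \<le> ln (real n)" using d by (simp add: ln_powr)
    have "q * ln (real n) \<le> ln (real n) - ln (real d)"
      using lnd \<epsilon> by (simp add: q_def field_simps)
    also have "\<dots> = ln (real n / real d)" using n1 d by (simp add: ln_div)
    finally have ratio: "q * ln (real n) \<le> ln (real n / real d)" .
    have "ln (real n / real d) / 100 \<le> ln (1 + real n / real d / 100)"
      using n1 d by (intro ln_add_one_divide_ge) simp
    also have "\<dots> \<le> ln (1 + real m / real k)"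
    proof -
      have "real n / real d / 100 \<le> real m / real d" using m(1) d by (simp add: field_simps)
      also have "\<dots> \<le> real m / real k" using k by (intro divide_left_mono) auto
      finally show ?thesis using n1 d by (simp add: add_pos_nonneg)
    qed
    also have "\<dots> \<le> (\<Sum>t<m. 1 / (real t + real k))" by (rule ln_le_sum_inverse[OF k(2)])
    finally have sum: "q * ln (real n) / 100 \<le> (\<Sum>t<m. 1 / (real t + real k))"
      using divide_right_mono[OF ratio, of 100] by (meson order.trans zero_le_numeral)
    have "2 * K = c1 * (real d / 2) * (q * ln (real n) / 100)"
      by (simp add: K_def c_def)
    also have "\<dots> \<le> c1 * real k * (\<Sum>t<m. 1 / (real t + real k))"
      using sum c1 k q n1 by (intro mult_mono) auto
    also have "\<dots> = (\<Sum>t<m. c1 * (real k / (real t + real k)))"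
      by (simp add: sum_distrib_left)
    finally have "ennreal (2 * K) \<le> ennreal (\<Sum>t<m. c1 * (real k / (real t + real k)))"
      by (rule ennreal_leI)
    also have "\<dots> \<le> (\<integral>\<^sup>+u. ennreal (expected_mistakes d n m R A (u(k := 1))) \<partial>prior k)"
      using expected_mistakes_prior[OF A[unfolded k(1)] k(2) m(2)] by (simp add: c1_def k(1))
    finally have avg: "ennreal (2 * K) \<le> (\<integral>\<^sup>+u. ennreal (expected_mistakes d n m R A (u(k := 1))) \<partial>prior k)" .
    \<comment> \<open>The average is at least \<open>2 * K\<close>, so values that all lie below
      \<open>K\<close> are contradictory without any strict inequality between integrals.\<close>
    have "\<exists>u. K \<le> expected_mistakes d n m R A (u(k := 1))"
    proof (rule ccontr)
      assume "\<not> (\<exists>u. K \<le> expected_mistakes d n m R A (u(k := 1)))"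
      then have "(\<integral>\<^sup>+u. ennreal (expected_mistakes d n m R A (u(k := 1))) \<partial>prior k) \<le> (\<integral>\<^sup>+u. ennreal K \<partial>prior k)"
        by (intro nn_integral_mono ennreal_leI) (simp add: not_le less_imp_le)
      also have "\<dots> = ennreal K"
        using prob_space.emeasure_space_1[OF prob_space_prior[of k]] by (simp del: space_prior)
      finally have "ennreal (2 * K) \<le> ennreal K" using avg by (rule order.trans[rotated])
      then show False using K by (simp add: ennreal_le_iff)
    qed
    then obtain u where u: "K \<le> expected_mistakes d n m R A (u(k := 1))" ..
    define w where "w = u(k := 1)"
    define r where "r = L2_set w {..<d}"
    have "0 < (\<Sum>i<d. (w i)\<^sup>2)"
      by (rule sum_pos2[where i = k]) (auto simp: k w_def)
    then have r: "0 < r" by (simp add: r_def L2_set_def)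
    have "L2_set (\<lambda>i. w i / r) {..<d} = L2_set (\<lambda>i. (1 / r) * w i) {..<d}" by simp
    also have "\<dots> = (1 / r) * r"
      unfolding r_def by (rule L2_set_right_distrib[symmetric]) (simp add: L2_set_nonneg)
    finally have "L2_set (\<lambda>i. w i / r) {..<d} = 1" using r by simp
    moreover have "c * real d * ln (real n) \<le> expected_mistakes d n m R A (\<lambda>i. w i / r)"
      using u unfolding expected_mistakes_divide[OF r] w_def K_def .
    ultimately show ?thesis by blast
  qed
  then show "\<exists>c::real. c > 0 \<and>
    (\<forall>(d::nat) (n::nat) (m::nat).
       d \<ge> 2 \<and> real n \<ge> real d powr (1 + \<epsilon>) \<and> real n / 100 \<le> real m \<and> m \<le> n \<longrightarrow>
       (\<forall>(R::real measure) (A::learner). online_learner d n R A \<longrightarrow>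
          (\<exists>w. L2_set w {..<d} = 1 \<and>
               expected_mistakes d n m R A w \<ge> c * real d * ln (real n))))"
    using c by blast
qed

end
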